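(* Consider universal conformal geometries $(V,Q,P,L)$ over $\mathbb{R}$, with $n=\dim V$. The quadratic form $Q$ is determined by its signature. The forms of signature $(k,l)$ and $(l,k)$ give the same geometries, so suppose that $k\ge l$. The dimension of a maximal symplectic subspace is then $2l$, so the geometry is non-degenerate if and only if $l\ge2$. The norms of $P$ and $L$ are either $1$, $0$ or $-1$. Unless $k=l$ or $Q(P)=Q(L)=0$, the pair $(Q(P),Q(L))$ determines uniquely the geometry; however, when $k=l$ and either $Q(P)\ne0$ or $Q(L)\ne0$, the signs of $Q(P)$ and $Q(L)$ can be flipped. In dimension $d=n-3$, not counting difference in sign, $l$ can be chosen with $2\le l\le d+1$, and $P$ and $L$ may be chosen in $9$ different ways, giving $9d/2$ (non-degenerate) geometries when $d$ is even, and $(9d-1)/2$ when $d$ is odd.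
   Context: For a quadratic form $Q$, $B(u,v)=Q(u+v)-Q(u)-Q(v)$ is the associated bilinear form. A universal conformal geometry of dimension $d$ over a field $\mathbb{K}$ is a tuple $(V,Q,P,L)$ where $V$ is a vector space of dimension $d+3$ over $\mathbb{K}$, $Q$ is a non-degenerate quadratic form with non-degenerate associated bilinear form $B$, and $P,L\in\mathbb{P}V$ are orthogonal with respect to $B$. Geometries are considered up to isomorphism, where $Q$ may be multiplied by any non-zero scalar without altering the isomorphism class. The norm of a point $[v]\in\mathbb{P}V$ is the class of $Q(v)$ in $\mathbb{K}^\times/(\mathbb{K}^\times)^2\cup\{0\}$ (over $\mathbb{R}$: its sign). A symplectic subspace of dimension $2m$ is a subspace on which $Q$ can be written as $x_1x_2+x_3x_4+\dots+x_{2m-1}x_{2m}$ in some basis. A hypercycle is a $c\in\mathbb{P}V$ with $Q(c)=0$; it is a point if $B(P,c)=0$, a hyperplane if $B(L,c)=0$, and ideal if both hold. The geometry is non-degenerate if there are a non-ideal point $p$ and a non-ideal hyperplane $h$ with $B(p,h)=0$.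
   Formalization: For odd d the number of geometries is proved to be (9d+1)/2, not (9d-1)/2 (for d=1 there are 5, not 4); and non-degeneracy is proved equivalent to l≥2 together with P≠L, since P=L of norm 0 is allowed and always gives a degenerate geometry. *)

theory Defs
  imports "HOL-Analysis.Analysis"
begin

section \<open>Quadratic forms\<close>

definition polar_form :: "('v::real_vector \<Rightarrow> real) \<Rightarrow> 'v \<Rightarrow> 'v \<Rightarrow> real" where
  "polar_form Q u v = Q (u + v) - Q u - Q v"

definition quadratic_form :: "('v::real_vector \<Rightarrow> real) \<Rightarrow> bool" where
  "quadratic_form Q \<longleftrightarrow> (\<forall>a v. Q (a *\<^sub>R v) = a\<^sup>2 * Q v) \<and> bilinear (polar_form Q)"

text \<open>The last conjunct is non-degeneracy of the form itself. It follows from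
  non-degeneracy of the associated bilinear form, and is listed because the two are
  required separately over a general field.\<close>

definition nondegenerate_form :: "('v::real_vector \<Rightarrow> real) \<Rightarrow> bool" where
  "nondegenerate_form Q \<longleftrightarrow> quadratic_form Q \<and>
     (\<forall>u. (\<forall>v. polar_form Q u v = 0) \<longrightarrow> u = 0) \<and>
     (\<forall>u. Q u = 0 \<and> (\<forall>v. polar_form Q u v = 0) \<longrightarrow> u = 0)"

definition isometric_forms ::
  "('v::real_vector \<Rightarrow> real) \<Rightarrow> ('w::real_vector \<Rightarrow> real) \<Rightarrow> bool" where
  "isometric_forms Q Q' \<longleftrightarrow> (\<exists>f. linear f \<and> bij f \<and> (\<forall>v. Q' (f v) = Q v))"

definition is_basis :: "nat \<Rightarrow> (nat \<Rightarrow> 'v::real_vector) \<Rightarrow> 'v set \<Rightarrow> bool" where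
  "is_basis N b W \<longleftrightarrow> inj_on b {..<N} \<and> independent (b ` {..<N}) \<and> span (b ` {..<N}) = W"

definition has_signature :: "('v::real_vector \<Rightarrow> real) \<Rightarrow> nat \<Rightarrow> nat \<Rightarrow> bool" where
  "has_signature Q k l \<longleftrightarrow> (\<exists>b. is_basis (k + l) b UNIV \<and>
     (\<forall>x. Q (\<Sum>i<k+l. x i *\<^sub>R b i) = (\<Sum>i<k. (x i)\<^sup>2) - (\<Sum>i=k..<k+l. (x i)\<^sup>2)))"

text \<open>The zero subspace is symplectic (of dimension 0); for a definite form it is the
  only symplectic subspace.\<close>

definition symplectic_subspace :: "('v::real_vector \<Rightarrow> real) \<Rightarrow> 'v set \<Rightarrow> bool" where
  "symplectic_subspace Q W \<longleftrightarrow> (\<exists>m b. is_basis (2 * m) b W \<and>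
     (\<forall>x. Q (\<Sum>i<2*m. x i *\<^sub>R b i) = (\<Sum>j<m. x (2 * j) * x (2 * j + 1))))"

definition maximal_symplectic_subspace :: "('v::real_vector \<Rightarrow> real) \<Rightarrow> 'v set \<Rightarrow> bool" where
  "maximal_symplectic_subspace Q W \<longleftrightarrow> symplectic_subspace Q W \<and>
     (\<forall>W'. symplectic_subspace Q W' \<and> W \<subseteq> W' \<longrightarrow> W' = W)"


section \<open>Points of the projective space\<close>

text \<open>A point of the projective space is a line through the origin, as a set of vectors.\<close>

definition proj_space :: "'v::real_vector set set" where
  "proj_space = {span {v} | v. v \<noteq> 0}"

definition proj_orthogonal ::
  "('v::real_vector \<Rightarrow> real) \<Rightarrow> 'v set \<Rightarrow> 'v set \<Rightarrow> bool" where
  "proj_orthogonal Q X Y \<longleftrightarrow> (\<forall>u\<in>X. \<forall>v\<in>Y. polar_form Q u v = 0)"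

definition proj_norm :: "('v::real_vector \<Rightarrow> real) \<Rightarrow> 'v set \<Rightarrow> real" where
  "proj_norm Q X = (THE s. \<exists>v\<in>X. v \<noteq> 0 \<and> s = sgn (Q v))"


section \<open>Universal conformal geometries\<close>

text \<open>A tuple (V,Q,P,L) is rendered as (Q,P,L), with V the whole type. P and L are
  allowed to coincide (they are then a point of norm 0).\<close>

type_synonym 'v geometry = "('v \<Rightarrow> real) \<times> 'v set \<times> 'v set"

text \<open>As the dimension is positive, the first conjunct also says that the space is
  finite-dimensional (the function \<^const>\<open>dim\<close> is 0 on infinite-dimensional spaces).\<close>

fun universal_conformal_geometry :: "nat \<Rightarrow> 'v::real_vector geometry \<Rightarrow> bool" where
  "universal_conformal_geometry d (Q, P, L) \<longleftrightarrow>
     dim (UNIV :: 'v set) = d + 3 \<and> nondegenerate_form Q \<and>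
     P \<in> proj_space \<and> L \<in> proj_space \<and> proj_orthogonal Q P L"

fun hypercycle :: "'v::real_vector geometry \<Rightarrow> 'v set \<Rightarrow> bool" where
  "hypercycle (Q, P, L) c \<longleftrightarrow> c \<in> proj_space \<and> (\<forall>v\<in>c. Q v = 0)"

fun point :: "'v::real_vector geometry \<Rightarrow> 'v set \<Rightarrow> bool" where
  "point (Q, P, L) c \<longleftrightarrow> hypercycle (Q, P, L) c \<and> proj_orthogonal Q P c"

fun hyperplane :: "'v::real_vector geometry \<Rightarrow> 'v set \<Rightarrow> bool" where
  "hyperplane (Q, P, L) c \<longleftrightarrow> hypercycle (Q, P, L) c \<and> proj_orthogonal Q L c"

definition ideal_hypercycle :: "'v::real_vector geometry \<Rightarrow> 'v set \<Rightarrow> bool" where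
  "ideal_hypercycle G c \<longleftrightarrow> point G c \<and> hyperplane G c"

fun nondegenerate_geometry :: "'v::real_vector geometry \<Rightarrow> bool" where
  "nondegenerate_geometry (Q, P, L) \<longleftrightarrow>
     (\<exists>p h. point (Q, P, L) p \<and> \<not> ideal_hypercycle (Q, P, L) p \<and>
            hyperplane (Q, P, L) h \<and> \<not> ideal_hypercycle (Q, P, L) h \<and>
            proj_orthogonal Q p h)"

text \<open>\<open>similar_geometries c\<close> relates two geometries by an isomorphism that multiplies the
  form by c. Geometries are classified up to an arbitrary non-zero factor; the case c = 1
  is the finer relation in which a difference in sign counts.\<close>

fun similar_geometries ::
  "real \<Rightarrow> 'v::real_vector geometry \<Rightarrow> 'w::real_vector geometry \<Rightarrow> bool" where
  "similar_geometries c (Q, P, L) (Q', P', L') \<longleftrightarrow>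
     (\<exists>f. linear f \<and> bij f \<and> (\<forall>v. Q' (f v) = c * Q v) \<and> f ` P = P' \<and> f ` L = L')"

definition isomorphic_geometries ::
  "'v::real_vector geometry \<Rightarrow> 'w::real_vector geometry \<Rightarrow> bool" where
  "isomorphic_geometries G G' \<longleftrightarrow> (\<exists>c. c \<noteq> 0 \<and> similar_geometries c G G')"

definition geometry_classes ::
  "('v geometry \<Rightarrow> 'v geometry \<Rightarrow> bool) \<Rightarrow> 'v geometry set \<Rightarrow> 'v geometry set set" where
  "geometry_classes R S = S // {(G, G'). G \<in> S \<and> G' \<in> S \<and> R G G'}"

end

theory Submission
  imports Defs
begin

text \<open>Sylvester's law is the independence of the positive part of one orthonormal frame from the
  negative part of another, and frames inside a non-degenerate space extend to the whole space;
  this settles signatures and maximal symplectic subspaces. The geometries are classified by Witt's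
  theorem for an ordered pair of distinct orthogonal lines, where at most four reflections suffice:
  first move P, then move L by reflections fixing P. So for distinct P and L the geometry is
  determined up to isometry by k and the two norms, and changing the sign of the form gives an
  involution that sends (k, s, t) to (n - k, -s, -t). Its only possible fixed point is (n/2, 0, 0),
  which exists when d is odd and accounts for the parity in the count.\<close>

section \<open>Polar forms and isometries\<close>

lemma polar_form_commute: "polar_form Q u v = polar_form Q v u"
  by (simp add: polar_form_def add.commute)

lemma form_add: "Q (u + v) = Q u + Q v + polar_form Q u v"
  by (simp add: polar_form_def)

context
  fixes Q :: "'v::real_vector \<Rightarrow> real"
  assumes Q: "quadratic_form Q"
begin

lemma bilinear_polar_form: "bilinear (polar_form Q)"
  using Q by (simp add: quadratic_form_def)

lemmas polar_form_simps =
  bilinear_ladd[OF bilinear_polar_form] bilinear_radd[OF bilinear_polar_form]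
  bilinear_lmul[OF bilinear_polar_form] bilinear_rmul[OF bilinear_polar_form]
  bilinear_lneg[OF bilinear_polar_form] bilinear_rneg[OF bilinear_polar_form]
  bilinear_lsub[OF bilinear_polar_form] bilinear_rsub[OF bilinear_polar_form]
  bilinear_lzero[OF bilinear_polar_form] bilinear_rzero[OF bilinear_polar_form]

lemma form_scaleR: "Q (a *\<^sub>R v) = a\<^sup>2 * Q v"
  using Q by (simp add: quadratic_form_def)

lemma form_zero: "Q 0 = 0"
  using form_scaleR[of 0 0] by simp

lemma form_uminus: "Q (- v) = Q v"
  using form_scaleR[of "-1" v] by simp

lemma form_diff: "Q (u - v) = Q u + Q v - polar_form Q u v"
  using form_add[of Q u "- v"] by (simp add: form_uminus polar_form_simps)

lemma polar_form_self: "polar_form Q u u = 2 * Q u"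
  using form_diff[of u u] by (simp add: form_zero)

lemma polar_form_sum_left:
  "polar_form Q (\<Sum>s\<in>S. t s *\<^sub>R g s) y = (\<Sum>s\<in>S. t s * polar_form Q (g s) y)"
  by (induction S rule: infinite_finite_induct) (simp_all add: polar_form_simps)

end

definition isometry :: "('v::real_vector \<Rightarrow> real) \<Rightarrow> ('w::real_vector \<Rightarrow> real) \<Rightarrow> ('v \<Rightarrow> 'w) \<Rightarrow> bool"
  where "isometry Q Q' f \<longleftrightarrow> linear f \<and> bij f \<and> (\<forall>v. Q' (f v) = Q v)"

lemma isometry_compose:
  "isometry Q Q' f \<Longrightarrow> isometry Q' Q'' g \<Longrightarrow> isometry Q Q'' (g \<circ> f)"
  by (simp add: isometry_def linear_compose bij_comp)

lemma isometry_polar_form: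
  "isometry Q Q' f \<Longrightarrow> polar_form Q' (f u) (f v) = polar_form Q u v"
  by (simp add: isometry_def polar_form_def linear_add[symmetric])

lemma span_singleton_scaleR:
  "c \<noteq> 0 \<Longrightarrow> span {c *\<^sub>R (v::'v::real_vector)} = span {v}"
  using span_image_scale[of "{v}" "\<lambda>_. c"] by simp

lemma span_singleton_eq:
  fixes u v :: "'v::real_vector"
  assumes "v \<noteq> 0" "v \<in> span {u}"
  shows "span {u} = span {v}"
proof -
  from assms(2) obtain c where c: "v = c *\<^sub>R u" by (auto simp: span_singleton)
  with assms(1) have "c \<noteq> 0" by auto
  with c show ?thesis by (simp add: span_singleton_scaleR)
qed

lemma isometry_span_singleton:
  "isometry Q Q' f \<Longrightarrow> f ` span {v} = span {f v}"
  using linear_span_image[of f "{v}"] by (simp add: isometry_def)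

section \<open>Witt's theorem for pairs of orthogonal lines\<close>

definition reflection :: "('v::real_vector \<Rightarrow> real) \<Rightarrow> 'v \<Rightarrow> 'v \<Rightarrow> 'v" where
  "reflection Q w x = x - (polar_form Q x w / Q w) *\<^sub>R w"

context
  fixes Q :: "'v::real_vector \<Rightarrow> real"
  assumes Q: "quadratic_form Q"
begin

lemma reflection_isometry:
  assumes "Q w \<noteq> 0"
  shows "isometry Q Q (reflection Q w)"
proof -
  let ?r = "reflection Q w"
  have lin: "linear ?r"
    by (rule linearI)
       (simp_all add: reflection_def polar_form_simps[OF Q] add_divide_distrib scaleR_add_left
         scaleR_diff_right)
  have "polar_form Q (?r x) w = - polar_form Q x w" for x
    using assms by (simp add: reflection_def polar_form_simps[OF Q] polar_form_self[OF Q])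
  then have "?r (?r x) = x" for x
    by (simp add: reflection_def[of Q w "?r x"]) (simp add: reflection_def)
  then have "bij ?r" by (intro o_bij[of ?r]) (auto simp: fun_eq_iff)
  moreover have "Q (?r x) = Q x" for x
    using assms
    by (simp add: reflection_def form_diff[OF Q] form_scaleR[OF Q] polar_form_simps[OF Q]
        power2_eq_square)
  ultimately show ?thesis using lin by (simp add: isometry_def)
qed

lemma reflection_fixes: "polar_form Q u w = 0 \<Longrightarrow> reflection Q w u = u"
  by (simp add: reflection_def)

lemma reflection_swap:
  assumes "Q v = Q v'" "Q (v - v') \<noteq> 0"
  shows "reflection Q (v - v') v = v'"
proof -
  have "polar_form Q v (v - v') = Q (v - v')"
    using assms(1) by (simp add: polar_form_simps[OF Q] polar_form_self[OF Q] form_diff[OF Q])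
  with assms(2) show ?thesis by (simp add: reflection_def)
qed

lemma transport_line_anisotropic:
  assumes "polar_form Q u v = 0" "polar_form Q u v' = 0" "Q v = Q v'"
    and ne: "Q (v - v') \<noteq> 0 \<or> Q (v + v') \<noteq> 0"
  shows "\<exists>f. isometry Q Q f \<and> f u = u \<and> f ` span {v} = span {v'}"
proof -
  obtain e :: real where e: "e = 1 \<or> e = -1" "Q (v - e *\<^sub>R v') \<noteq> 0"
  proof (cases "Q (v - v') = 0")
    case True
    with ne that[of "-1"] show ?thesis by simp
  next
    case False
    with that[of 1] show ?thesis by simp
  qed
  let ?w = "v - e *\<^sub>R v'"
  let ?f = "reflection Q ?w"
  have eq: "Q v = Q (e *\<^sub>R v')" using e(1) assms(3) by (auto simp: form_scaleR[OF Q])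
  have f: "isometry Q Q ?f" by (rule reflection_isometry[OF e(2)])
  have "?f ` span {v} = span {e *\<^sub>R v'}"
    by (simp only: isometry_span_singleton[OF f] reflection_swap[OF eq e(2)])
  also have "\<dots> = span {v'}" using e(1) by (intro span_singleton_scaleR) auto
  finally have "?f ` span {v} = span {v'}" .
  moreover have "?f u = u"
    using assms by (intro reflection_fixes) (simp add: polar_form_simps[OF Q])
  ultimately show ?thesis using f by blast
qed

text \<open>If v and v' are isotropic and orthogonal, no reflection moves one to the other; then two
  reflections do, through an isotropic vector orthogonal to neither.\<close>

lemma transport_line:
  assumes uv: "polar_form Q u v = 0" "polar_form Q u v' = 0" and eq: "Q v = Q v'"
    and w1: "\<exists>w. polar_form Q u w = 0 \<and> polar_form Q v w \<noteq> 0"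
    and w2: "\<exists>w. polar_form Q u w = 0 \<and> polar_form Q v' w \<noteq> 0"
  shows "\<exists>f. isometry Q Q f \<and> f u = u \<and> f ` span {v} = span {v'}"
proof (cases "Q (v - v') \<noteq> 0 \<or> Q (v + v') \<noteq> 0")
  case True
  then show ?thesis by (rule transport_line_anisotropic[OF uv eq])
next
  case False
  then have "Q (v - v') = 0" "Q (v + v') = 0" by auto
  then have 0: "Q v = 0" "Q v' = 0" "polar_form Q v v' = 0" "polar_form Q v' v = 0"
    using eq form_add[of Q v v'] form_diff[OF Q, of v v'] polar_form_commute[of Q v v'] by auto
  obtain a where a: "polar_form Q u a = 0" "polar_form Q v a \<noteq> 0" using w1 by blast
  obtain b where b: "polar_form Q u b = 0" "polar_form Q v' b \<noteq> 0" using w2 by blast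
  have "\<exists>x. polar_form Q u x = 0 \<and> polar_form Q v x \<noteq> 0 \<and> polar_form Q v' x \<noteq> 0"
  proof (cases "polar_form Q v' a = 0 \<and> polar_form Q v b = 0")
    case True
    with a b show ?thesis by (intro exI[of _ "a + b"]) (simp add: polar_form_simps[OF Q])
  next
    case False
    with a b show ?thesis by blast
  qed
  then obtain x where x: "polar_form Q u x = 0" "polar_form Q v x \<noteq> 0" "polar_form Q v' x \<noteq> 0"
    by blast
  define w where "w = x - (Q x / polar_form Q v x) *\<^sub>R v"
  have w: "polar_form Q u w = 0" "polar_form Q v w \<noteq> 0" "polar_form Q w v' \<noteq> 0"
    using x uv 0 by (simp_all add: w_def polar_form_simps[OF Q] polar_form_self[OF Q]
        polar_form_commute[of Q x v'])
  have "Q w = 0"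
    using x(2) 0(1) by (simp add: w_def form_diff[OF Q] form_scaleR[OF Q] polar_form_simps[OF Q]
        polar_form_commute[of Q x v])
  with w 0 have q: "Q (v - w) \<noteq> 0" "Q (w - v') \<noteq> 0" "Q v = Q w" "Q w = Q v'"
    by (simp_all add: form_diff[OF Q])
  obtain f where f: "isometry Q Q f" "f u = u" "f ` span {v} = span {w}"
    using transport_line_anisotropic[OF uv(1) w(1) q(3)] q(1) by blast
  obtain g where g: "isometry Q Q g" "g u = u" "g ` span {w} = span {v'}"
    using transport_line_anisotropic[OF w(1) uv(2) q(4)] q(2) by blast
  have "(g \<circ> f) ` span {v} = span {v'}" by (simp only: image_comp[symmetric] f(3) g(3))
  moreover have "(g \<circ> f) u = u" using f(2) g(2) by simp
  ultimately show ?thesis using isometry_compose[OF f(1) g(1)] by blast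
qed

end

lemma nondegenerate_form_quadratic: "nondegenerate_form Q \<Longrightarrow> quadratic_form Q"
  by (simp add: nondegenerate_form_def)

lemma nondegenerate_form_witness:
  "nondegenerate_form Q \<Longrightarrow> u \<noteq> 0 \<Longrightarrow> \<exists>w. polar_form Q u w \<noteq> 0"
  by (auto simp: nondegenerate_form_def)

lemma nondegenerate_form_orthogonal_witness:
  assumes N: "nondegenerate_form Q" and "u \<noteq> 0" and v: "v \<notin> span {u}"
  shows "\<exists>w. polar_form Q u w = 0 \<and> polar_form Q v w \<noteq> 0"
proof (rule ccontr)
  assume "\<not> ?thesis"
  then have *: "polar_form Q v w = 0" if "polar_form Q u w = 0" for w using that by blast
  note Q = nondegenerate_form_quadratic[OF N]
  obtain a where a: "polar_form Q u a \<noteq> 0" using nondegenerate_form_witness[OF N \<open>u \<noteq> 0\<close>] ..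
  let ?c = "polar_form Q v a / polar_form Q u a"
  have "polar_form Q (v - ?c *\<^sub>R u) x = 0" for x
    using *[of "x - (polar_form Q u x / polar_form Q u a) *\<^sub>R a"] a
    by (simp add: polar_form_simps[OF Q])
  then have "v - ?c *\<^sub>R u = 0" using nondegenerate_form_witness[OF N] by blast
  with v show False by (simp add: span_singleton)
qed

lemma equal_sgn_rescale:
  assumes Q: "quadratic_form Q" and "sgn r = sgn (Q v)"
  shows "\<exists>c. c \<noteq> 0 \<and> Q (c *\<^sub>R v) = r"
proof (cases "r = 0")
  case True
  with assms(2) show ?thesis by (intro exI[of _ 1]) (simp add: sgn_0_0)
next
  case False
  with assms(2) have "r / Q v > 0" by (auto simp: sgn_if zero_less_divide_iff split: if_splits)
  moreover from this have "Q v \<noteq> 0" by auto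
  ultimately show ?thesis
    by (intro exI[of _ "sqrt (r / Q v)"]) (auto simp: form_scaleR[OF Q])
qed

lemma transport_pair:
  fixes Q :: "'v::real_vector \<Rightarrow> real"
  assumes N: "nondegenerate_form Q"
    and nz: "u \<noteq> 0" "v \<noteq> 0" "u' \<noteq> 0" "v' \<noteq> 0"
    and orth: "polar_form Q u v = 0" "polar_form Q u' v' = 0"
    and ne: "span {u} \<noteq> span {v}" "span {u'} \<noteq> span {v'}"
    and sg: "sgn (Q u) = sgn (Q u')" "sgn (Q v) = sgn (Q v')"
  shows "\<exists>f. isometry Q Q f \<and> f ` span {u} = span {u'} \<and> f ` span {v} = span {v'}"
proof -
  note Q = nondegenerate_form_quadratic[OF N]
  obtain c where c: "c \<noteq> 0" "Q (c *\<^sub>R u') = Q u" using equal_sgn_rescale[OF Q sg(1)] by blast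
  obtain e where e: "e \<noteq> 0" "Q (e *\<^sub>R v') = Q v" using equal_sgn_rescale[OF Q sg(2)] by blast
  have "\<exists>f. isometry Q Q f \<and> f 0 = 0 \<and> f ` span {u} = span {c *\<^sub>R u'}"
    using nz c nondegenerate_form_witness[OF N]
    by (intro transport_line[OF Q]) (simp_all add: polar_form_simps[OF Q])
  then obtain f where f: "isometry Q Q f" "f ` span {u} = span {u'}"
    by (auto simp: span_singleton_scaleR[OF c(1)])
  have fu: "span {f u} = span {u'}" using f by (simp add: isometry_span_singleton)
  have "u' \<in> span {f u}" unfolding fu by (simp add: span_base)
  then obtain k where k: "u' = k *\<^sub>R f u" by (auto simp: span_singleton)
  have inj: "inj f" using f(1) by (simp add: isometry_def bij_is_inj)
  have lin: "linear f" using f(1) by (simp add: isometry_def)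
  have fv: "f v \<noteq> 0" using nz(2) inj lin by (metis injD linear_0)
  have "f v \<notin> span {u'}"
  proof
    assume "f v \<in> span {u'}"
    then have "f v \<in> f ` span {u}" using f(2) by simp
    then have "v \<in> span {u}" using inj by (simp add: inj_image_mem_iff)
    then show False using ne(1) span_singleton_eq[OF nz(2)] by metis
  qed
  moreover have "e *\<^sub>R v' \<notin> span {u'}"
    using ne(2) span_singleton_eq[of "e *\<^sub>R v'" u'] e(1) nz(4) by (auto simp: span_singleton_scaleR)
  moreover have "polar_form Q u' (f v) = 0"
    using isometry_polar_form[OF f(1), of u v] orth(1) by (simp add: k polar_form_simps[OF Q])
  moreover have "Q (f v) = Q (e *\<^sub>R v')" using e(2) f(1) by (simp add: isometry_def)
  ultimately have "\<exists>g. isometry Q Q g \<and> g u' = u' \<and> g ` span {f v} = span {e *\<^sub>R v'}"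
    using orth(2)
    by (intro transport_line[OF Q] nondegenerate_form_orthogonal_witness[OF N nz(3)])
       (simp_all add: polar_form_simps[OF Q])
  then obtain g where g: "isometry Q Q g" "g u' = u'" "g ` span {f v} = span {v'}"
    by (auto simp: span_singleton_scaleR[OF e(1)])
  have "(g \<circ> f) ` span {u} = span {u'}"
    by (simp only: image_comp[symmetric] f(2) isometry_span_singleton[OF g(1)] g(2))
  moreover have "(g \<circ> f) ` span {v} = span {v'}"
    by (simp only: image_comp[symmetric] isometry_span_singleton[OF f(1)] g(3))
  ultimately show ?thesis using isometry_compose[OF f(1) g(1)] by blast
qed

section \<open>Orthonormal frames and Sylvester's law of inertia\<close>

definition orthonormal_frame ::
  "('v::real_vector \<Rightarrow> real) \<Rightarrow> 'v set \<Rightarrow> 'v set \<Rightarrow> bool" where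
  "orthonormal_frame Q A C \<longleftrightarrow> finite A \<and> finite C \<and> (\<forall>a\<in>A. Q a = 1) \<and> (\<forall>c\<in>C. Q c = -1) \<and>
     (\<forall>x\<in>A \<union> C. \<forall>y\<in>A \<union> C. x \<noteq> y \<longrightarrow> polar_form Q x y = 0)"

lemma orthonormal_frame_disjoint: "orthonormal_frame Q A C \<Longrightarrow> A \<inter> C = {}"
  by (force simp: orthonormal_frame_def)

lemma orthonormal_frame_card_Un:
  "orthonormal_frame Q A C \<Longrightarrow> card (A \<union> C) = card A + card C"
  using orthonormal_frame_disjoint[of Q A C]
  by (intro card_Un_disjoint) (auto simp: orthonormal_frame_def)

lemma orthonormal_frame_neg:
  "orthonormal_frame Q A C \<Longrightarrow> orthonormal_frame (\<lambda>v. - Q v) C A"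
  by (auto simp: orthonormal_frame_def polar_form_def; fastforce)

lemma quadratic_form_neg:
  assumes "quadratic_form Q"
  shows "quadratic_form (\<lambda>v. - Q v)"
proof -
  have "polar_form (\<lambda>v. - Q v) = (\<lambda>u v. - polar_form Q u v)"
    by (simp add: polar_form_def fun_eq_iff)
  with assms show ?thesis
    by (simp add: quadratic_form_def bilinear_def linear_compose_neg)
qed

lemma nondegenerate_form_neg:
  assumes "nondegenerate_form Q"
  shows "nondegenerate_form (\<lambda>v. - Q v)"
proof -
  have "polar_form (\<lambda>v. - Q v) = (\<lambda>u v. - polar_form Q u v)"
    by (simp add: polar_form_def fun_eq_iff)
  with assms show ?thesis
    by (simp add: nondegenerate_form_def quadratic_form_neg)
qed

context
  fixes Q :: "'v::real_vector \<Rightarrow> real"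
  assumes Q: "quadratic_form Q"
begin

lemma form_orthogonal_sum:
  assumes "finite I" "\<And>i j. i \<in> I \<Longrightarrow> j \<in> I \<Longrightarrow> i \<noteq> j \<Longrightarrow> polar_form Q (b i) (b j) = 0"
  shows "Q (\<Sum>i\<in>I. x i *\<^sub>R b i) = (\<Sum>i\<in>I. (x i)\<^sup>2 * Q (b i))"
  using assms
proof (induction I)
  case empty
  then show ?case by (simp add: form_zero[OF Q])
next
  case (insert i I)
  have "polar_form Q (\<Sum>j\<in>I. x j *\<^sub>R b j) (x i *\<^sub>R b i) = 0"
    unfolding polar_form_sum_left[OF Q] using insert
    by (intro sum.neutral) (auto simp: polar_form_simps[OF Q])
  then have "polar_form Q (x i *\<^sub>R b i) (\<Sum>j\<in>I. x j *\<^sub>R b j) = 0"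
    by (simp add: polar_form_commute)
  then show ?case using insert by (simp add: form_add[of Q] form_scaleR[OF Q])
qed

lemma polar_form_orthogonal_sum:
  assumes "finite I" "\<And>i j. i \<in> I \<Longrightarrow> j \<in> I \<Longrightarrow> i \<noteq> j \<Longrightarrow> polar_form Q (b i) (b j) = 0" "j \<in> I"
  shows "polar_form Q (\<Sum>i\<in>I. x i *\<^sub>R b i) (b j) = x j * (2 * Q (b j))"
proof -
  have "(\<Sum>i\<in>I. x i * polar_form Q (b i) (b j)) = (\<Sum>i\<in>I. if i = j then x j * (2 * Q (b j)) else 0)"
    using assms by (intro sum.cong) (auto simp: polar_form_self[OF Q])
  then show ?thesis using assms by (simp add: polar_form_sum_left[OF Q])
qed

lemma orthonormal_frame_polar_form_sum:
  assumes "orthonormal_frame Q A C" "y \<in> A \<union> C"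
  shows "polar_form Q (\<Sum>x\<in>A\<union>C. t x *\<^sub>R x) y = t y * (2 * Q y)"
  using polar_form_orthogonal_sum[of "A \<union> C" "\<lambda>x. x" y t] assms
  by (simp add: orthonormal_frame_def)

lemma orthonormal_frame_nonzero:
  "orthonormal_frame Q A C \<Longrightarrow> x \<in> A \<union> C \<Longrightarrow> Q x \<noteq> 0"
  by (auto simp: orthonormal_frame_def)

lemma orthonormal_frame_independent:
  assumes F: "orthonormal_frame Q A C"
  shows "independent (A \<union> C)"
proof
  have fin: "finite (A \<union> C)" using F by (simp add: orthonormal_frame_def)
  assume "dependent (A \<union> C)"
  then obtain t y where y: "y \<in> A \<union> C" "t y \<noteq> 0" and 0: "(\<Sum>x\<in>A\<union>C. t x *\<^sub>R x) = 0"
    using real_vector.dependent_finite[OF fin] by auto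
  have "t y * (2 * Q y) = 0"
    using orthonormal_frame_polar_form_sum[OF F y(1), of t] 0 by (simp add: polar_form_simps[OF Q])
  with y orthonormal_frame_nonzero[OF F] show False by simp
qed

lemma orthonormal_frame_nondegenerate:
  assumes F: "orthonormal_frame Q A C" and sp: "span (A \<union> C) = UNIV"
  shows "nondegenerate_form Q"
proof -
  have "u = 0" if u: "\<forall>v. polar_form Q u v = 0" for u
  proof -
    have fin: "finite (A \<union> C)" using F by (simp add: orthonormal_frame_def)
    have "u \<in> span (A \<union> C)" by (simp add: sp)
    then obtain t where t: "u = (\<Sum>x\<in>A\<union>C. t x *\<^sub>R x)" by (auto simp: span_finite[OF fin])
    have "t x = 0" if "x \<in> A \<union> C" for x
      using orthonormal_frame_polar_form_sum[OF F that, of t] u orthonormal_frame_nonzero[OF F that]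
      by (simp flip: t)
    then show ?thesis by (simp add: t)
  qed
  then show ?thesis using Q by (simp add: nondegenerate_form_def)
qed

lemma orthonormal_frames_card_le:
  assumes F: "orthonormal_frame Q A C" and F': "orthonormal_frame Q A' C'"
    and sp: "span (A' \<union> C') = UNIV"
  shows "card A \<le> card A'"
proof -
  have fin: "finite A" "finite C'" "finite A'"
    using F F' by (auto simp: orthonormal_frame_def)
  have one: "Q a = 1" if "a \<in> A" for a using F that by (simp add: orthonormal_frame_def)
  have mone: "Q c = -1" if "c \<in> C'" for c using F' that by (simp add: orthonormal_frame_def)
  have disj: "A \<inter> C' = {}" using one mone by force
  have "independent (A \<union> C')"
  proof
    assume "dependent (A \<union> C')"
    then obtain t y where y: "y \<in> A \<union> C'" "t y \<noteq> 0" and 0: "(\<Sum>x\<in>A\<union>C'. t x *\<^sub>R x) = 0"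
      using real_vector.dependent_finite[of "A \<union> C'"] fin by auto
    let ?p = "\<Sum>x\<in>A. t x *\<^sub>R x" and ?q = "\<Sum>x\<in>C'. t x *\<^sub>R x"
    have "Q ?p = (\<Sum>x\<in>A. (t x)\<^sup>2 * Q x)"
      using F by (intro form_orthogonal_sum) (auto simp: orthonormal_frame_def)
    then have p: "Q ?p = (\<Sum>x\<in>A. (t x)\<^sup>2)" using one by simp
    have "Q ?q = (\<Sum>x\<in>C'. (t x)\<^sup>2 * Q x)"
      using F' by (intro form_orthogonal_sum) (auto simp: orthonormal_frame_def)
    then have q: "Q ?q = - (\<Sum>x\<in>C'. (t x)\<^sup>2)" using mone by (simp add: sum_negf)
    have "?p + ?q = 0" using 0 fin disj by (simp add: sum.union_disjoint)
    then have "?p = - ?q" by (rule eq_neg_iff_add_eq_0[THEN iffD2])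
    then have "Q ?p = Q ?q" by (simp add: form_uminus[OF Q])
    then have "(\<Sum>x\<in>A. (t x)\<^sup>2) = 0" "(\<Sum>x\<in>C'. (t x)\<^sup>2) = 0"
      using p q sum_nonneg[of A "\<lambda>x. (t x)\<^sup>2"] sum_nonneg[of C' "\<lambda>x. (t x)\<^sup>2"] by auto
    with y fin show False by (auto simp: sum_nonneg_eq_0_iff)
  qed
  moreover have "A \<union> C' \<subseteq> span (A' \<union> C')" by (simp add: sp)
  ultimately have "card (A \<union> C') \<le> card (A' \<union> C')"
    using fin by (intro independent_span_bound[THEN conjunct2]) auto
  then show ?thesis
    using orthonormal_frame_card_Un[OF F'] disj fin by (simp add: card_Un_disjoint)
qed

end

lemma orthonormal_frames_card_le':
  assumes Q: "quadratic_form Q" and F: "orthonormal_frame Q A C" and F': "orthonormal_frame Q A' C'"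
    and sp: "span (A' \<union> C') = UNIV"
  shows "card C \<le> card C'"
  using orthonormal_frames_card_le[OF quadratic_form_neg[OF Q] orthonormal_frame_neg[OF F]
      orthonormal_frame_neg[OF F']] sp by (simp add: Un_commute)

lemma orthonormal_frame_insert:
  assumes F: "orthonormal_frame Q A C" and x: "Q x \<noteq> 0" "\<forall>y\<in>A\<union>C. polar_form Q x y = 0"
    and Q: "quadratic_form Q"
  shows "\<exists>z. z \<notin> A \<union> C \<and> (orthonormal_frame Q (insert z A) C \<or> orthonormal_frame Q A (insert z C))"
proof -
  obtain c where c: "Q (c *\<^sub>R x) = sgn (Q x)"
    using equal_sgn_rescale[OF Q, of "sgn (Q x)" x] by auto
  let ?z = "c *\<^sub>R x"
  have z: "\<forall>y\<in>A\<union>C. polar_form Q ?z y = 0" "\<forall>y\<in>A\<union>C. polar_form Q y ?z = 0"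
    using x(2) by (auto simp: polar_form_simps[OF Q] polar_form_commute[of Q _ x])
  have nz: "Q ?z = 1 \<or> Q ?z = -1" using x(1) c by (auto simp: sgn_if)
  have "?z \<notin> A \<union> C"
    using z(1) nz polar_form_self[OF Q, of ?z] by force
  moreover have "orthonormal_frame Q (insert ?z A) C \<or> orthonormal_frame Q A (insert ?z C)"
    using nz F z unfolding orthonormal_frame_def by auto
  ultimately show ?thesis by blast
qed

lemma orthonormal_frame_project:
  assumes Q: "quadratic_form Q" and F: "orthonormal_frame Q A C"
  shows "\<exists>s\<in>span (A \<union> C). \<forall>y\<in>A\<union>C. polar_form Q (v - s) y = 0"
proof -
  let ?s = "\<Sum>x\<in>A\<union>C. (polar_form Q v x / (2 * Q x)) *\<^sub>R x"
  have "?s \<in> span (A \<union> C)" by (intro span_sum span_scale span_base)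
  moreover have "polar_form Q (v - ?s) y = 0" if "y \<in> A \<union> C" for y
    using orthonormal_frame_nonzero[OF Q F that]
    by (simp add: polar_form_simps[OF Q] orthonormal_frame_polar_form_sum[OF Q F that])
  ultimately show ?thesis by blast
qed

lemma orthogonal_span:
  assumes Q: "quadratic_form Q" and "\<forall>y\<in>S. polar_form Q x y = 0" "s \<in> span S"
  shows "polar_form Q x s = 0"
  using assms(3,2)
  by (induction rule: span_induct_alt) (simp_all add: polar_form_simps[OF Q])

lemma orthonormal_frame_extend_step:
  fixes Q :: "'v::real_vector \<Rightarrow> real"
  assumes N: "nondegenerate_form Q" and F: "orthonormal_frame Q A C" and "span (A \<union> C) \<noteq> UNIV"
  shows "\<exists>z. z \<notin> A \<union> C \<and> (orthonormal_frame Q (insert z A) C \<or> orthonormal_frame Q A (insert z C))"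
proof -
  note Q = nondegenerate_form_quadratic[OF N]
  obtain v where v: "v \<notin> span (A \<union> C)" using assms(3) by blast
  obtain s where s: "s \<in> span (A \<union> C)" "\<forall>y\<in>A\<union>C. polar_form Q (v - s) y = 0"
    using orthonormal_frame_project[OF Q F] by blast
  define u where "u = v - s"
  have "u \<noteq> 0" using v s(1) by (auto simp: u_def)
  then obtain w where w: "polar_form Q u w \<noteq> 0" using nondegenerate_form_witness[OF N] by blast
  obtain s' where s': "s' \<in> span (A \<union> C)" "\<forall>y\<in>A\<union>C. polar_form Q (w - s') y = 0"
    using orthonormal_frame_project[OF Q F] by blast
  have u: "\<forall>y\<in>A\<union>C. polar_form Q u y = 0" using s(2) by (simp add: u_def)
  define x where "x = w - s'"
  have "polar_form Q u s' = 0" by (rule orthogonal_span[OF Q u s'(1)])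
  then have ux: "polar_form Q u x \<noteq> 0" using w by (simp add: x_def polar_form_simps[OF Q])
  have x: "\<forall>y\<in>A\<union>C. polar_form Q x y = 0" using s'(2) by (simp add: x_def)
  have "Q u \<noteq> 0 \<or> Q x \<noteq> 0 \<or> Q (u + x) \<noteq> 0" using ux by (auto simp: form_add[of Q u])
  moreover have "\<forall>y\<in>A\<union>C. polar_form Q (u + x) y = 0" using u x by (simp add: polar_form_simps[OF Q])
  ultimately show ?thesis using orthonormal_frame_insert[OF F _ _ Q] u x by blast
qed

lemma orthonormal_frame_extend:
  fixes Q :: "'v::real_vector \<Rightarrow> real"
  assumes N: "nondegenerate_form Q" and T: "finite T" "span T = (UNIV :: 'v set)"
    and F: "orthonormal_frame Q A C"
  shows "\<exists>A' C'. A \<subseteq> A' \<and> C \<subseteq> C' \<and> orthonormal_frame Q A' C' \<and> span (A' \<union> C') = UNIV"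
  using F
proof (induction "card T - card (A \<union> C)" arbitrary: A C rule: less_induct)
  case less
  show ?case
  proof (cases "span (A \<union> C) = UNIV")
    case True
    with less.prems show ?thesis by blast
  next
    case False
    have bound: "card (A' \<union> C') \<le> card T" if "orthonormal_frame Q A' C'" for A' C'
      using independent_span_bound[OF T(1)
          orthonormal_frame_independent[OF nondegenerate_form_quadratic[OF N] that]] T(2) by simp
    obtain z where z: "z \<notin> A \<union> C"
      "orthonormal_frame Q (insert z A) C \<or> orthonormal_frame Q A (insert z C)"
      using orthonormal_frame_extend_step[OF N less.prems False] by blast
    have fin: "finite (A \<union> C)" using less.prems by (simp add: orthonormal_frame_def)
    from z(2) show ?thesis
    proof
      assume *: "orthonormal_frame Q (insert z A) C"
      have "card (insert z A \<union> C) = Suc (card (A \<union> C))" using z(1) fin by simp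
      then have "card T - card (insert z A \<union> C) < card T - card (A \<union> C)" using bound[OF *] by linarith
      from less.hyps[OF this *] show ?thesis by (metis insert_subset)
    next
      assume *: "orthonormal_frame Q A (insert z C)"
      have "card (A \<union> insert z C) = Suc (card (A \<union> C))" using z(1) fin by simp
      then have "card T - card (A \<union> insert z C) < card T - card (A \<union> C)" using bound[OF *] by linarith
      from less.hyps[OF this *] show ?thesis by (metis insert_subset)
    qed
  qed
qed

lemma sum_scaleR_indicator:
  "finite I \<Longrightarrow> i \<in> I \<Longrightarrow> (\<Sum>j\<in>I. (if j = i then 1 else 0) *\<^sub>R b j) = (b i :: 'v::real_vector)"
  by (simp add: if_distrib[of "\<lambda>r. r *\<^sub>R _"] cong: if_cong)

lemma has_signature_iff_frame:
  fixes Q :: "'v::real_vector \<Rightarrow> real"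
  assumes Q: "quadratic_form Q"
  shows "has_signature Q k l \<longleftrightarrow>
    (\<exists>A C. orthonormal_frame Q A C \<and> span (A \<union> C) = UNIV \<and> card A = k \<and> card C = l)"
proof
  assume "has_signature Q k l"
  then obtain b where b: "is_basis (k + l) b (UNIV :: 'v set)"
    and F: "\<And>x. Q (\<Sum>i<k+l. x i *\<^sub>R b i) = (\<Sum>i<k. (x i)\<^sup>2) - (\<Sum>i=k..<k+l. (x i)\<^sup>2)"
    by (auto simp: has_signature_def)
  have P: "polar_form Q (\<Sum>i<k+l. x i *\<^sub>R b i) (\<Sum>i<k+l. y i *\<^sub>R b i)
      = (\<Sum>i<k. 2 * (x i * y i)) - (\<Sum>i=k..<k+l. 2 * (x i * y i))" for x y
  proof -
    have "(\<Sum>i<k+l. x i *\<^sub>R b i) + (\<Sum>i<k+l. y i *\<^sub>R b i) = (\<Sum>i<k+l. (x i + y i) *\<^sub>R b i)"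
      by (simp add: sum.distrib scaleR_add_left)
    then show ?thesis
      unfolding polar_form_def F
      by (simp only: F) (simp add: power2_sum sum.distrib algebra_simps)
  qed
  let ?d = "\<lambda>i j. if j = i then 1 else 0 :: real"
  have d: "b i = (\<Sum>j<k+l. ?d i j *\<^sub>R b j)" if "i < k + l" for i
    using that by (simp add: sum_scaleR_indicator)
  have polar: "polar_form Q (b i) (b j) = (if i = j then if i < k then 2 else -2 else 0)"
    if "i < k + l" "j < k + l" for i j
  proof -
    have *: "2 * (?d i m * ?d j m) = (if m = i then (if i = j then 2 else 0) else 0)" for m
      by simp
    show ?thesis
      using that by (subst d[OF that(1)], subst d[OF that(2)]) (simp only: P *, simp)
  qed
  have inj: "inj_on b {..<k+l}" using b by (simp add: is_basis_def)
  have sub: "{..<k} \<subseteq> {..<k+l}" "{k..<k+l} \<subseteq> {..<k+l}" by auto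
  have split: "b ` {..<k} \<union> b ` {k..<k+l} = b ` {..<k+l}"
    by (auto simp flip: image_Un)
  have "Q (b i) = (if i < k then 1 else -1)" if "i < k + l" for i
    using polar[OF that that] polar_form_self[OF Q, of "b i"] by (auto split: if_splits)
  then have "orthonormal_frame Q (b ` {..<k}) (b ` {k..<k+l})"
    unfolding orthonormal_frame_def split using polar by auto
  moreover have "span (b ` {..<k} \<union> b ` {k..<k+l}) = UNIV" using b by (simp add: split is_basis_def)
  moreover have "card (b ` {..<k}) = k" "card (b ` {k..<k+l}) = l"
    using card_image[OF inj_on_subset[OF inj sub(1)]] card_image[OF inj_on_subset[OF inj sub(2)]]
    by simp_all
  ultimately show "\<exists>A C. orthonormal_frame Q A C \<and> span (A \<union> C) = UNIV \<and> card A = k \<and> card C = l"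
    by blast
next
  assume "\<exists>A C. orthonormal_frame Q A C \<and> span (A \<union> C) = UNIV \<and> card A = k \<and> card C = l"
  then obtain A C where F: "orthonormal_frame Q A C" and sp: "span (A \<union> C) = UNIV"
    and card: "card A = k" "card C = l" by blast
  have fin: "finite A" "finite C" using F by (auto simp: orthonormal_frame_def)
  obtain a where a: "bij_betw a {0..<k} A" using ex_bij_betw_nat_finite[OF fin(1)] card by auto
  obtain c where c: "bij_betw c {0..<l} C" using ex_bij_betw_nat_finite[OF fin(2)] card by auto
  define b where "b i = (if i < k then a i else c (i - k))" for i
  have bA: "b ` {..<k} = A" using a by (force simp: b_def bij_betw_def image_def)
  have bC: "b ` {k..<k+l} = C"
  proof -
    have "b ` {k..<k+l} = c ` ((\<lambda>i. i - k) ` {k..<k+l})"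
      unfolding image_image by (intro image_cong) (auto simp: b_def)
    also have "(\<lambda>i. i - k) ` {k..<k+l} = {0..<l}" by (auto simp: image_def intro!: bexI[of _ "_ + k"])
    finally show ?thesis using c by (simp add: bij_betw_def)
  qed
  have ivl: "{..<k+l} = {..<k} \<union> {k..<k+l}" by auto
  have im: "b ` {..<k+l} = A \<union> C" by (simp only: ivl image_Un bA bC)
  have inj: "inj_on b {..<k+l}"
    using orthonormal_frame_card_Un[OF F] card by (intro eq_card_imp_inj_on) (simp_all add: im)
  have "is_basis (k + l) b (UNIV :: 'v set)"
    using inj orthonormal_frame_independent[OF Q F] sp by (simp add: is_basis_def im)
  moreover have "Q (\<Sum>i<k+l. x i *\<^sub>R b i) = (\<Sum>i<k. (x i)\<^sup>2) - (\<Sum>i=k..<k+l. (x i)\<^sup>2)" for x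
  proof -
    have "polar_form Q (b i) (b j) = 0" if "i \<in> {..<k+l}" "j \<in> {..<k+l}" "i \<noteq> j" for i j
    proof -
      have "b i \<noteq> b j" using that inj by (meson inj_onD)
      moreover have "b i \<in> A \<union> C" "b j \<in> A \<union> C" using that im by blast+
      ultimately show ?thesis using F by (simp add: orthonormal_frame_def)
    qed
    then have "Q (\<Sum>i<k+l. x i *\<^sub>R b i) = (\<Sum>i<k+l. (x i)\<^sup>2 * Q (b i))"
      by (intro form_orthogonal_sum[OF Q]) auto
    also have "\<dots> = (\<Sum>i<k. (x i)\<^sup>2 * Q (b i)) + (\<Sum>i=k..<k+l. (x i)\<^sup>2 * Q (b i))"
      unfolding ivl by (intro sum.union_disjoint) auto
    also have "(\<Sum>i<k. (x i)\<^sup>2 * Q (b i)) = (\<Sum>i<k. (x i)\<^sup>2)"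
      using F bA by (intro sum.cong) (auto simp: orthonormal_frame_def)
    also have "(\<Sum>i=k..<k+l. (x i)\<^sup>2 * Q (b i)) = (\<Sum>i=k..<k+l. - (x i)\<^sup>2)"
    proof (intro sum.cong refl)
      fix i assume "i \<in> {k..<k+l}"
      then have "b i \<in> C" using bC by blast
      then show "(x i)\<^sup>2 * Q (b i) = - (x i)\<^sup>2" using F by (simp add: orthonormal_frame_def)
    qed
    finally show ?thesis by (simp add: sum_negf)
  qed
  ultimately show "has_signature Q k l" by (auto simp: has_signature_def)
qed

section \<open>Signatures and isometries of forms\<close>

lemma has_signature_dim:
  "has_signature (Q :: 'v::real_vector \<Rightarrow> real) k l \<Longrightarrow> k + l = dim (UNIV :: 'v set)"
proof -
  assume "has_signature Q k l"
  then obtain b where b: "is_basis (k + l) b (UNIV :: 'v set)" by (auto simp: has_signature_def)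
  then have "dim (UNIV :: 'v set) = card (b ` {..<k+l})"
    by (intro real_vector.dim_eq_card) (auto simp: is_basis_def)
  with b show "k + l = dim (UNIV :: 'v set)" by (simp add: is_basis_def card_image)
qed

lemma has_signature_unique:
  assumes Q: "quadratic_form Q" and "has_signature Q k l" "has_signature Q k' l'"
  shows "k = k'" "l = l'"
proof -
  obtain A C where F: "orthonormal_frame Q A C" "span (A \<union> C) = UNIV" "card A = k" "card C = l"
    using assms by (auto simp: has_signature_iff_frame)
  obtain A' C' where F': "orthonormal_frame Q A' C'" "span (A' \<union> C') = UNIV" "card A' = k'" "card C' = l'"
    using assms by (auto simp: has_signature_iff_frame)
  show "k = k'"
    using orthonormal_frames_card_le[OF Q F(1) F'(1,2)] orthonormal_frames_card_le[OF Q F'(1) F(1,2)]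
      F F' by simp
  show "l = l'"
    using orthonormal_frames_card_le'[OF Q F(1) F'(1,2)] orthonormal_frames_card_le'[OF Q F'(1) F(1,2)]
      F F' by simp
qed

lemma finite_basis_exists:
  assumes "0 < dim (UNIV :: 'v::real_vector set)"
  shows "\<exists>T :: 'v set. finite T \<and> independent T \<and> span T = UNIV \<and> card T = dim (UNIV :: 'v set)"
proof -
  obtain T :: "'v set" where T: "independent T" "UNIV \<subseteq> span T" "card T = dim (UNIV :: 'v set)"
    by (metis real_vector.basis_exists)
  then show ?thesis using assms by (metis card_gt_0_iff top.extremum_unique)
qed

lemma has_signature_exists:
  fixes Q :: "'v::real_vector \<Rightarrow> real"
  assumes N: "nondegenerate_form Q" and "0 < dim (UNIV :: 'v set)"
  shows "\<exists>k l. has_signature Q k l"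
proof -
  obtain T :: "'v set" where T: "finite T" "span T = UNIV" using finite_basis_exists[OF assms(2)] by blast
  have "orthonormal_frame Q {} {}" by (simp add: orthonormal_frame_def)
  from orthonormal_frame_extend[OF N T this] show ?thesis
    using nondegenerate_form_quadratic[OF N] by (auto simp: has_signature_iff_frame)
qed

lemma has_signature_neg:
  assumes Q: "quadratic_form Q" and "has_signature Q k l"
  shows "has_signature (\<lambda>v. - Q v) l k"
proof -
  obtain A C where "orthonormal_frame Q A C" "span (A \<union> C) = UNIV" "card A = k" "card C = l"
    using assms by (auto simp: has_signature_iff_frame)
  then show ?thesis unfolding has_signature_iff_frame[OF quadratic_form_neg[OF Q]]
    by (metis orthonormal_frame_neg Un_commute)
qed

lemma form_with_signature_exists:
  assumes "0 < dim (UNIV :: 'v::real_vector set)" and kl: "k + l = dim (UNIV :: 'v set)"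
  shows "\<exists>Q :: 'v \<Rightarrow> real. nondegenerate_form Q \<and> has_signature Q k l"
proof -
  obtain T :: "'v set" where T: "finite T" "independent T" "span T = UNIV" "card T = k + l"
    using finite_basis_exists[OF assms(1)] kl by auto
  obtain A where A: "A \<subseteq> T" "card A = k" using T(4) by (metis le_add1 obtain_subset_with_card_n)
  let ?C = "T - A"
  let ?r = "\<lambda>b v. representation T v b"
  define Q where "Q v = (\<Sum>a\<in>A. (?r a v)\<^sup>2) - (\<Sum>c\<in>?C. (?r c v)\<^sup>2)" for v
  have add: "?r b (u + v) = ?r b u + ?r b v" for b u v
    using T by (simp add: real_vector.representation_add)
  have scale: "?r b (s *\<^sub>R v) = s * ?r b v" for b s v
    using T by (simp add: real_vector.representation_scale)
  have P: "polar_form Q u v = (\<Sum>a\<in>A. 2 * (?r a u * ?r a v)) - (\<Sum>c\<in>?C. 2 * (?r c u * ?r c v))" for u v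
    by (simp add: polar_form_def Q_def add power2_sum sum.distrib algebra_simps)
  have "bilinear (polar_form Q)"
    unfolding bilinear_def
    by (auto intro!: linearI simp: P add scale algebra_simps sum.distrib sum_distrib_left)
  moreover have "Q (s *\<^sub>R v) = s\<^sup>2 * Q v" for s v
    by (simp add: Q_def scale power_mult_distrib sum_distrib_left right_diff_distrib)
  ultimately have quad: "quadratic_form Q" by (simp add: quadratic_form_def)
  have fin: "finite A" "finite ?C" using T(1) A(1) finite_subset by auto
  have basis: "?r b x = (if b = x then 1 else 0)" if "x \<in> T" for b x
    using T(2) that by (simp add: real_vector.representation_basis)
  have sq: "(\<Sum>a\<in>S. (?r a x)\<^sup>2) = (if x \<in> S then 1 else 0)" if "x \<in> T" "finite S" for S x
    using that by (simp add: basis if_distrib[of "\<lambda>z. z\<^sup>2"] cong: if_cong)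
  have pr: "(\<Sum>a\<in>S. 2 * (?r a x * ?r a y)) = 0" if "x \<in> T" "y \<in> T" "x \<noteq> y" for S x y
    using that by (intro sum.neutral) (auto simp: basis)
  have "orthonormal_frame Q A ?C"
    using fin A(1) unfolding orthonormal_frame_def
    by (auto simp: P pr Q_def sq subset_iff)
  moreover have "A \<union> ?C = T" using A(1) by auto
  moreover have "card ?C = l" using A T(1,4) by (simp add: card_Diff_subset finite_subset)
  ultimately show ?thesis
    using has_signature_iff_frame[OF quad] orthonormal_frame_nondegenerate[OF quad] T(3) A(2) by metis
qed

lemma isometry_frame:
  assumes f: "isometry Q Q' f" and F: "orthonormal_frame Q A C"
  shows "orthonormal_frame Q' (f ` A) (f ` C)"
  using f F isometry_polar_form[OF f] unfolding orthonormal_frame_def isometry_def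
  by (auto simp: ball_Un)

lemma isometry_has_signature:
  fixes f :: "'v::real_vector \<Rightarrow> 'w::real_vector"
  assumes f: "isometry Q Q' f" and Q: "quadratic_form Q" "quadratic_form Q'"
    and "has_signature Q k l"
  shows "has_signature Q' k l"
proof -
  obtain A C where F: "orthonormal_frame Q A C" "span (A \<union> C) = UNIV" "card A = k" "card C = l"
    using assms by (auto simp: has_signature_iff_frame)
  have lin: "linear f" and bij: "bij f" using f by (auto simp: isometry_def)
  have "span (f ` A \<union> f ` C) = f ` span (A \<union> C)"
    by (simp add: linear_span_image[OF lin] flip: image_Un)
  then have "span (f ` A \<union> f ` C) = UNIV" using F(2) bij by (simp add: bij_is_surj)
  moreover have "card (f ` A) = k" "card (f ` C) = l"
    using F bij by (auto simp: card_image inj_on_subset[OF bij_is_inj])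
  ultimately show ?thesis
    using isometry_frame[OF f F(1)] by (auto simp: has_signature_iff_frame[OF Q(2)])
qed

lemma has_signature_isometry:
  fixes Q :: "'v::real_vector \<Rightarrow> real" and Q' :: "'w::real_vector \<Rightarrow> real"
  assumes N: "nondegenerate_form Q" and Q': "quadratic_form Q'"
    and "has_signature Q k l" "has_signature Q' k l"
  shows "\<exists>f. isometry Q Q' f"
proof -
  note Q = nondegenerate_form_quadratic[OF N]
  obtain A C where F: "orthonormal_frame Q A C" "span (A \<union> C) = UNIV" "card A = k" "card C = l"
    using assms Q by (auto simp: has_signature_iff_frame)
  obtain A' C' where F': "orthonormal_frame Q' A' C'" "span (A' \<union> C') = UNIV" "card A' = k" "card C' = l"
    using assms by (auto simp: has_signature_iff_frame)
  have fin: "finite A" "finite C" "finite A'" "finite C'"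
    using F F' by (auto simp: orthonormal_frame_def)
  obtain ga where ga: "bij_betw ga A A'"
    using finite_same_card_bij[of A A'] fin F F' by auto
  obtain gc where gc: "bij_betw gc C C'"
    using finite_same_card_bij[of C C'] fin F F' by auto
  note disj = orthonormal_frame_disjoint[OF F(1)] orthonormal_frame_disjoint[OF F'(1)]
  define g where "g x = (if x \<in> A then ga x else gc x)" for x
  have gA: "bij_betw g A A'" using ga by (simp add: g_def cong: bij_betw_cong)
  have gC: "bij_betw g C C'"
    using gc disj(1) by (subst bij_betw_cong[of _ _ gc]) (auto simp: g_def)
  have gb: "bij_betw g (A \<union> C) (A' \<union> C')" using bij_betw_combine[OF gA gC disj(2)] .
  obtain f where lin: "linear f" and fg: "\<forall>x\<in>A \<union> C. f x = g x"
    using linear_independent_extend[OF orthonormal_frame_independent[OF Q F(1)]] by blast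
  have fb: "f x \<in> A' \<union> C'" "Q' (f x) = Q x" if "x \<in> A \<union> C" for x
    using that fg gA gC F(1) F'(1) by (auto simp: orthonormal_frame_def bij_betw_def)
  have orth: "polar_form Q' (f x) (f y) = 0" if "x \<in> A \<union> C" "y \<in> A \<union> C" "x \<noteq> y" for x y
  proof -
    have "f x \<noteq> f y" using that fg gb by (metis bij_betw_def inj_onD)
    then show ?thesis using F'(1) fb that by (auto simp: orthonormal_frame_def)
  qed
  have iso: "Q' (f v) = Q v" for v
  proof -
    have "v \<in> span (A \<union> C)" by (simp add: F)
    then obtain t where t: "v = (\<Sum>x\<in>A\<union>C. t x *\<^sub>R x)"
      using span_finite[of "A \<union> C"] fin by auto
    have "f v = (\<Sum>x\<in>A\<union>C. t x *\<^sub>R f x)" by (simp add: t linear_sum[OF lin] linear_scale[OF lin])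
    then have "Q' (f v) = (\<Sum>x\<in>A\<union>C. (t x)\<^sup>2 * Q' (f x))"
      using form_orthogonal_sum[OF Q', of "A \<union> C" f t] fin orth by simp
    also have "\<dots> = (\<Sum>x\<in>A\<union>C. (t x)\<^sup>2 * Q x)" using fb by (intro sum.cong) auto
    also have "\<dots> = Q v"
      unfolding t using form_orthogonal_sum[OF Q, of "A \<union> C" "\<lambda>x. x" t] fin F(1)
      by (simp add: orthonormal_frame_def)
    finally show ?thesis .
  qed
  have "inj f"
  proof (rule linear_injective_0[OF lin, THEN iffD2], intro allI impI)
    fix v assume "f v = 0"
    then have "polar_form Q v w = 0" for w
      using iso by (simp add: polar_form_def linear_add[OF lin] form_zero[OF Q'] flip: iso)
    then show "v = 0" using nondegenerate_form_witness[OF N] by blast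
  qed
  moreover have "range f = UNIV"
  proof -
    have "range f = span (f ` (A \<union> C))" using F(2) by (simp add: linear_span_image[OF lin])
    also have "f ` (A \<union> C) = A' \<union> C'" using fg gb by (auto simp: bij_betw_def image_iff)
    finally show ?thesis using F' by simp
  qed
  ultimately show ?thesis using lin iso by (auto simp: isometry_def bij_def)
qed

lemma isometric_forms_iff: "isometric_forms Q Q' \<longleftrightarrow> (\<exists>f. isometry Q Q' f)"
  by (simp add: isometric_forms_def isometry_def)

lemma has_signature_iff_isometric:
  assumes "nondegenerate_form Q" "nondegenerate_form Q'" "has_signature Q k l"
  shows "has_signature Q' k l \<longleftrightarrow> isometric_forms Q Q'"
  using assms isometry_has_signature has_signature_isometry
  unfolding isometric_forms_iff by (metis nondegenerate_form_quadratic)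

section \<open>Symplectic subspaces\<close>

lemma sum_lessThan_double:
  "(\<Sum>i<2 * m. f i) = (\<Sum>j<m. f (2 * j) + f (2 * j + 1 :: nat) :: 'a::comm_monoid_add)"
  by (induction m) (simp_all add: add.assoc)

lemma minimal_spanning_independent:
  fixes B :: "'v::real_vector set"
  assumes "finite B" "independent I" "I \<subseteq> span B" "card B \<le> card I"
  shows "independent B \<and> card B = card I"
proof -
  obtain S where S: "S \<subseteq> B" "independent S" "B \<subseteq> span S"
    using real_vector.maximal_independent_subset by blast
  have "span B \<subseteq> span S" using S(3) by (simp add: span_minimal)
  then have "card I \<le> card S"
    using independent_span_bound[of S I] S assms finite_subset by blast
  then have "S = B" using S(1) assms by (intro card_seteq) auto
  then show ?thesis using S(2) assms(4) \<open>card I \<le> card S\<close> by simp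
qed

lemma symplectic_subspace_frame:
  fixes Q :: "'v::real_vector \<Rightarrow> real"
  assumes Q: "quadratic_form Q" and W: "symplectic_subspace Q W"
  shows "\<exists>A C. orthonormal_frame Q A C \<and> card A = card C \<and> span (A \<union> C) = W"
proof -
  obtain m b where b: "is_basis (2 * m) b W"
    and F: "\<And>x. Q (\<Sum>i<2*m. x i *\<^sub>R b i) = (\<Sum>j<m. x (2 * j) * x (2 * j + 1))"
    using W by (auto simp: symplectic_subspace_def)
  have P: "polar_form Q (\<Sum>i<2*m. x i *\<^sub>R b i) (\<Sum>i<2*m. y i *\<^sub>R b i)
      = (\<Sum>j<m. x (2 * j) * y (2 * j + 1) + x (2 * j + 1) * y (2 * j))" for x y
  proof -
    have "(\<Sum>i<2*m. x i *\<^sub>R b i) + (\<Sum>i<2*m. y i *\<^sub>R b i) = (\<Sum>i<2*m. (x i + y i) *\<^sub>R b i)"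
      by (simp add: sum.distrib scaleR_add_left)
    then show ?thesis
      unfolding polar_form_def F by (simp only: F) (simp add: sum.distrib algebra_simps)
  qed
  define e :: "real \<Rightarrow> nat \<Rightarrow> nat \<Rightarrow> real"
    where "e s j i = (if i div 2 = j then if even i then 1 else s else 0)" for s j i
  define p where "p s j = b (2 * j) + s *\<^sub>R b (2 * j + 1)" for s j
  have p: "p s j = (\<Sum>i<2*m. e s j i *\<^sub>R b i)" if "j < m" for s j
  proof -
    have "(\<Sum>i<2*m. e s j i *\<^sub>R b i) = (\<Sum>j'<m. if j' = j then p s j else 0)"
      unfolding sum_lessThan_double by (intro sum.cong) (auto simp: e_def p_def)
    then show ?thesis using that by simp
  qed
  have pp: "polar_form Q (p s i) (p t j) = (if i = j then s + t else 0)" if "i < m" "j < m" for s t i j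
  proof -
    have "e s i (2 * j') * e t j (2 * j' + 1) + e s i (2 * j' + 1) * e t j (2 * j')
        = (if j' = i then if i = j then s + t else 0 else 0)" for j'
      by (auto simp: e_def)
    then show ?thesis using that by (simp only: p P) simp
  qed
  have Qp: "Q (p s j) = s" if "j < m" for s j
    using pp[OF that that, of s s] polar_form_self[OF Q, of "p s j"] by simp
  let ?A = "p 1 ` {..<m}" and ?C = "p (-1) ` {..<m}"
  have inj: "inj_on (p s) {..<m}" if "s \<noteq> 0" for s
    using pp[of _ _ s s] that by (intro inj_onI) (metis add_self_div_2 lessThan_iff zero_eq_add_iff_both_eq_0 double_zero)
  have "orthonormal_frame Q ?A ?C"
    unfolding orthonormal_frame_def using pp Qp by auto
  moreover have "card ?A = card ?C" using inj[of 1] inj[of "-1"] by (simp add: card_image)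
  moreover have "span (?A \<union> ?C) = W"
  proof -
    have b2: "b (2 * j) = (1/2) *\<^sub>R p 1 j + (1/2) *\<^sub>R p (-1) j"
      "b (2 * j + 1) = (1/2) *\<^sub>R p 1 j - (1/2) *\<^sub>R p (-1) j" for j
      by (simp_all add: p_def scaleR_add_right scaleR_diff_right flip: scaleR_add_left)
    have "b i \<in> span (?A \<union> ?C)" if "i < 2 * m" for i
    proof -
      have j: "i div 2 < m" using that by simp
      have "p 1 (i div 2) \<in> span (?A \<union> ?C)" "p (-1) (i div 2) \<in> span (?A \<union> ?C)"
        using j by (auto intro!: span_base)
      moreover have "i = 2 * (i div 2) \<or> i = 2 * (i div 2) + 1" by presburger
      ultimately show ?thesis by (metis b2 span_add span_diff span_scale)
    qed
    then have "b ` {..<2*m} \<subseteq> span (?A \<union> ?C)" by auto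
    moreover have "p s j \<in> span (b ` {..<2*m})" if "j < m" for s j
      unfolding p_def using that by (intro span_add span_scale span_base imageI) auto
    then have "?A \<union> ?C \<subseteq> span (b ` {..<2*m})" by auto
    ultimately have "span (?A \<union> ?C) = span (b ` {..<2*m})"
      by (metis span_eq)
    then show ?thesis using b by (simp add: is_basis_def)
  qed
  ultimately show ?thesis by blast
qed

lemma frame_symplectic_subspace:
  fixes Q :: "'v::real_vector \<Rightarrow> real"
  assumes Q: "quadratic_form Q" and F: "orthonormal_frame Q A C" and card: "card A = card C"
  shows "symplectic_subspace Q (span (A \<union> C))"
proof -
  define m where "m = card A"
  have fin: "finite A" "finite C" using F by (auto simp: orthonormal_frame_def)
  obtain a where a: "bij_betw a {0..<m} A" using ex_bij_betw_nat_finite[OF fin(1)] m_def by auto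
  obtain c where c: "bij_betw c {0..<m} C" using ex_bij_betw_nat_finite[OF fin(2)] card m_def by auto
  have ac: "a j \<in> A" "c j \<in> C" if "j < m" for j
    using that a c by (auto simp: bij_betw_def)
  have ac': "a i \<noteq> a j" "c i \<noteq> c j" if "i < m" "j < m" "i \<noteq> j" for i j
    using that inj_onD[OF bij_betw_imp_inj_on[OF a], of i j]
      inj_onD[OF bij_betw_imp_inj_on[OF c], of i j] by auto
  have Qac: "Q (a j) = 1" "Q (c j) = -1" if "j < m" for j
    using ac[OF that] F by (auto simp: orthonormal_frame_def)
  have F': "polar_form Q x y = 0" if "x \<in> A \<union> C" "y \<in> A \<union> C" "x \<noteq> y" for x y
    using F that unfolding orthonormal_frame_def by blast
  have ne: "a i \<noteq> c j" if "i < m" "j < m" for i j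
    using Qac(1)[OF that(1)] Qac(2)[OF that(2)] by auto
  have orth: "polar_form Q (a i) (c j) = 0" "polar_form Q (c j) (a i) = 0" if "i < m" "j < m" for i j
    using ac[OF that(1)] ac[OF that(2)] ne[OF that] by (auto intro!: F')
  have orth': "polar_form Q (a i) (a j) = 0" "polar_form Q (c i) (c j) = 0"
    if "i < m" "j < m" "i \<noteq> j" for i j
    using ac[OF that(1)] ac[OF that(2)] ac'[OF that] by (auto intro!: F')
  define b where "b i = (1/2) *\<^sub>R a (i div 2) + (if even i then 1/2 else -1/2) *\<^sub>R c (i div 2)" for i
  have b2: "a j = b (2 * j) + b (2 * j + 1)" "c j = b (2 * j) - b (2 * j + 1)" for j
    by (simp_all add: b_def flip: scaleR_add_left)
  have spb: "span (b ` {..<2*m}) = span (A \<union> C)"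
  proof -
    have "b i \<in> span (A \<union> C)" if "i < 2 * m" for i
      unfolding b_def using ac[of "i div 2"] that by (intro span_add span_scale span_base) auto
    moreover have "a j \<in> span (b ` {..<2*m})" "c j \<in> span (b ` {..<2*m})" if "j < m" for j
      unfolding b2 using that by (intro span_add span_diff span_base imageI; simp)+
    moreover have "A = a ` {..<m}" "C = c ` {..<m}"
      using a c by (auto simp: bij_betw_def atLeast0LessThan)
    ultimately show ?thesis by (intro span_eq[THEN iffD2]) auto
  qed
  have cardAC: "card (A \<union> C) = 2 * m"
    using orthonormal_frame_card_Un[OF F] card by (simp add: m_def)
  have "card (b ` {..<2*m}) \<le> card (A \<union> C)" using card_image_le[of "{..<2*m}" b] cardAC by simp
  then have ind: "independent (b ` {..<2*m})" "card (b ` {..<2*m}) = card {..<2*m}"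
    using minimal_spanning_independent[OF _ orthonormal_frame_independent[OF Q F], of "b ` {..<2*m}"]
      spb cardAC by (auto simp: span_superset)
  have "is_basis (2 * m) b (span (A \<union> C))"
    using ind spb by (simp add: is_basis_def eq_card_imp_inj_on)
  moreover have "Q (\<Sum>i<2*m. x i *\<^sub>R b i) = (\<Sum>j<m. x (2 * j) * x (2 * j + 1))" for x
  proof -
    let ?s = "\<lambda>j. (x (2 * j) + x (2 * j + 1)) / 2" and ?t = "\<lambda>j. (x (2 * j) - x (2 * j + 1)) / 2"
    define z where "z j = ?s j *\<^sub>R a j + ?t j *\<^sub>R c j" for j
    have "x (2 * j) *\<^sub>R b (2 * j) + x (2 * j + 1) *\<^sub>R b (2 * j + 1) = 1 *\<^sub>R z j" for j
      by (simp add: b_def z_def add_divide_distrib diff_divide_distrib algebra_simps)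
    then have "(\<Sum>i<2*m. x i *\<^sub>R b i) = (\<Sum>j<m. 1 *\<^sub>R z j)"
      unfolding sum_lessThan_double by (intro sum.cong) auto
    moreover have "Q (\<Sum>j<m. 1 *\<^sub>R z j) = (\<Sum>j<m. 1\<^sup>2 * Q (z j))"
      using orth orth' by (intro form_orthogonal_sum[OF Q]) (auto simp: z_def polar_form_simps[OF Q])
    moreover have "Q (z j) = x (2 * j) * x (2 * j + 1)" if "j < m" for j
      using that
      by (simp add: z_def form_add[of Q] form_scaleR[OF Q] polar_form_simps[OF Q] Qac orth)
         (simp add: power2_eq_square field_simps)
    ultimately show ?thesis by simp
  qed
  ultimately show ?thesis by (auto simp: symplectic_subspace_def)
qed

lemma dim_frame_span:
  assumes "quadratic_form Q" and F: "orthonormal_frame Q A C"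
  shows "dim (span (A \<union> C)) = card A + card C"
  using real_vector.dim_eq_card[OF _ orthonormal_frame_independent[OF assms], of "span (A \<union> C)"]
    orthonormal_frame_card_Un[OF F] by (simp add: span_span)

lemma maximal_symplectic_subspaces:
  fixes Q :: "'v::real_vector \<Rightarrow> real"
  assumes N: "nondegenerate_form Q" and sig: "has_signature Q k l" and "l \<le> k"
  shows "\<exists>W. maximal_symplectic_subspace Q W"
    and "maximal_symplectic_subspace Q W \<Longrightarrow> dim W = 2 * l"
proof -
  note Q = nondegenerate_form_quadratic[OF N]
  obtain A0 C0 where F0: "orthonormal_frame Q A0 C0" "span (A0 \<union> C0) = UNIV" "card A0 = k" "card C0 = l"
    using sig Q by (auto simp: has_signature_iff_frame)
  have fin0: "finite (A0 \<union> C0)" using F0 by (simp add: orthonormal_frame_def)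
  have bound: "card C \<le> l" if "orthonormal_frame Q A C" for A C
    using orthonormal_frames_card_le'[OF Q that F0(1,2)] F0 by simp
  have "dim W = 2 * l" if max: "maximal_symplectic_subspace Q W" for W
  proof -
    obtain A C where F: "orthonormal_frame Q A C" "card A = card C" "span (A \<union> C) = W"
      using symplectic_subspace_frame[OF Q, of W] max unfolding maximal_symplectic_subspace_def by blast
    obtain A' C' where F': "A \<subseteq> A'" "C \<subseteq> C'" "orthonormal_frame Q A' C'" "span (A' \<union> C') = UNIV"
      using orthonormal_frame_extend[OF N fin0 F0(2) F(1)] by blast
    have "has_signature Q (card A') (card C')" using F' has_signature_iff_frame[OF Q] by blast
    then have c': "card A' = k" "card C' = l" using has_signature_unique[OF Q _ sig] by auto
    have "card C = l"
    proof (rule ccontr)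
      assume "card C \<noteq> l"
      then have "card C < l" using bound[OF F(1)] by simp
      then have "A \<noteq> A'" "C \<noteq> C'" using c' F(2) \<open>l \<le> k\<close> by auto
      then obtain a c where a: "a \<in> A'" "a \<notin> A" and c: "c \<in> C'" "c \<notin> C" using F' by blast
      have G: "orthonormal_frame Q (insert a A) (insert c C)"
        using F'(1-3) F(1) a c unfolding orthonormal_frame_def by (auto simp: subset_iff)
      have "card (insert a A) = card (insert c C)"
        using F(1,2) a c by (simp add: orthonormal_frame_def)
      from frame_symplectic_subspace[OF Q G this] max
      have "span (insert a A \<union> insert c C) = W"
        using F(3) span_mono[of "A \<union> C" "insert a A \<union> insert c C"]
        by (auto simp: maximal_symplectic_subspace_def)
      then have "dim (span (insert a A \<union> insert c C)) = dim (span (A \<union> C))" using F(3) by simp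
      then show False
        using F(1) a c unfolding dim_frame_span[OF Q G] dim_frame_span[OF Q F(1)]
        by (simp add: orthonormal_frame_def)
    qed
    then show ?thesis using dim_frame_span[OF Q F(1), unfolded F(3)] F(2) by simp
  qed
  then show "maximal_symplectic_subspace Q W \<Longrightarrow> dim W = 2 * l" .
  obtain A1 where A1: "A1 \<subseteq> A0" "card A1 = l" using \<open>l \<le> k\<close> F0(3) by (metis obtain_subset_with_card_n)
  have F1: "orthonormal_frame Q A1 C0"
    using F0(1) A1(1) unfolding orthonormal_frame_def by (auto simp: subset_iff intro: finite_subset)
  have "W' = span (A1 \<union> C0)" if W': "symplectic_subspace Q W'" "span (A1 \<union> C0) \<subseteq> W'" for W'
  proof (rule ccontr)
    assume "W' \<noteq> span (A1 \<union> C0)"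
    then obtain z where z: "z \<in> W'" "z \<notin> span (A1 \<union> C0)" using W'(2) by blast
    obtain A C where F: "orthonormal_frame Q A C" "card A = card C" "span (A \<union> C) = W'"
      using symplectic_subspace_frame[OF Q W'(1)] by blast
    have "independent (insert z (A1 \<union> C0))"
      using orthonormal_frame_independent[OF Q F1] z(2) by (simp add: independent_insert)
    moreover have "insert z (A1 \<union> C0) \<subseteq> span (A \<union> C)"
      using z(1) W'(2) F(3) span_superset[of "A1 \<union> C0"] by auto
    ultimately have "card (insert z (A1 \<union> C0)) \<le> card (A \<union> C)"
      using F(1) by (intro independent_span_bound[THEN conjunct2]) (auto simp: orthonormal_frame_def)
    moreover have "z \<notin> A1 \<union> C0" using z(2) span_base by blast
    moreover have "finite (A1 \<union> C0)" using F1 by (simp add: orthonormal_frame_def)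
    ultimately show False
      using orthonormal_frame_card_Un[OF F(1)] orthonormal_frame_card_Un[OF F1] F(2) bound[OF F(1)] A1 F0(4)
      by simp
  qed
  moreover have "symplectic_subspace Q (span (A1 \<union> C0))"
    using frame_symplectic_subspace[OF Q F1] A1 F0(4) by simp
  ultimately show "\<exists>W. maximal_symplectic_subspace Q W"
    unfolding maximal_symplectic_subspace_def by blast
qed

section \<open>Classification of pairs of orthogonal points\<close>

lemma proj_spaceE:
  assumes "P \<in> proj_space"
  obtains u where "u \<noteq> 0" "P = span {u}"
  using assms by (auto simp: proj_space_def)

lemma span_singleton_in_proj_space: "u \<noteq> 0 \<Longrightarrow> span {u} \<in> proj_space"
  by (auto simp: proj_space_def)

lemma proj_orthogonal_span:
  assumes Q: "quadratic_form Q"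
  shows "proj_orthogonal Q (span {u}) (span {v}) \<longleftrightarrow> polar_form Q u v = 0"
proof
  assume "proj_orthogonal Q (span {u}) (span {v})"
  then show "polar_form Q u v = 0" by (simp add: proj_orthogonal_def span_base)
qed (auto simp: proj_orthogonal_def span_singleton polar_form_simps[OF Q])

lemma proj_norm_span:
  assumes Q: "quadratic_form Q" and "u \<noteq> 0"
  shows "proj_norm Q (span {u}) = sgn (Q u)"
  unfolding proj_norm_def
proof (rule the_equality)
  show "\<exists>v\<in>span {u}. v \<noteq> 0 \<and> sgn (Q u) = sgn (Q v)" using assms(2) by (auto intro: span_base)
qed (auto simp: span_singleton form_scaleR[OF Q] sgn_if zero_less_mult_iff)

lemma geometry_vectorsE:
  assumes "universal_conformal_geometry d (Q, P, L)"
  obtains u v where "u \<noteq> 0" "v \<noteq> 0" "P = span {u}" "L = span {v}" "polar_form Q u v = 0"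
    "proj_norm Q P = sgn (Q u)" "proj_norm Q L = sgn (Q v)" "nondegenerate_form Q" "quadratic_form Q"
proof -
  have N: "nondegenerate_form Q" and "P \<in> proj_space" "L \<in> proj_space" and o: "proj_orthogonal Q P L"
    using assms by auto
  then obtain u v where "u \<noteq> 0" "P = span {u}" "v \<noteq> 0" "L = span {v}" by (metis proj_spaceE)
  with that N o nondegenerate_form_quadratic[OF N] show thesis
    by (simp add: proj_orthogonal_span proj_norm_span)
qed

lemma proj_norm_in: "universal_conformal_geometry d (Q, P, L) \<Longrightarrow>
    proj_norm Q P \<in> {1, 0, -1} \<and> proj_norm Q L \<in> {1, 0, -1}"
  by (erule geometry_vectorsE) (simp add: sgn_if)

lemma proj_norm_self_orthogonal:
  assumes "universal_conformal_geometry d (Q, P, P)"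
  shows "proj_norm Q P = 0"
proof -
  obtain u where u: "u \<noteq> 0" "P = span {u}" using assms by (auto elim: proj_spaceE)
  have Q: "quadratic_form Q" using assms by (simp add: nondegenerate_form_quadratic)
  have "polar_form Q u u = 0" using assms by (simp add: u(2) proj_orthogonal_span[OF Q])
  then show ?thesis by (simp add: u proj_norm_span[OF Q] polar_form_self[OF Q])
qed

lemma universal_conformal_geometry_neg:
  assumes "universal_conformal_geometry d (Q, P, L)"
  shows "universal_conformal_geometry d (\<lambda>v. - Q v, P, L)"
    "proj_norm (\<lambda>v. - Q v) P = - proj_norm Q P" "proj_norm (\<lambda>v. - Q v) L = - proj_norm Q L"
proof -
  obtain u v where uv: "u \<noteq> 0" "v \<noteq> 0" "P = span {u}" "L = span {v}" "polar_form Q u v = 0"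
    "proj_norm Q P = sgn (Q u)" "proj_norm Q L = sgn (Q v)" "nondegenerate_form Q" "quadratic_form Q"
    using assms by (rule geometry_vectorsE)
  note Q' = quadratic_form_neg[OF uv(9)]
  have "polar_form (\<lambda>v. - Q v) u v = 0" using uv(5) by (simp add: polar_form_def)
  then show "universal_conformal_geometry d (\<lambda>v. - Q v, P, L)"
    using assms nondegenerate_form_neg[OF uv(8)] by (simp add: uv(3,4) proj_orthogonal_span[OF Q'])
  show "proj_norm (\<lambda>v. - Q v) P = - proj_norm Q P" "proj_norm (\<lambda>v. - Q v) L = - proj_norm Q L"
    unfolding uv(6,7) by (simp_all add: uv(1-4) proj_norm_span[OF Q'] sgn_minus)
qed

lemma similar_geometries_of_norms:
  fixes Q :: "'v::real_vector \<Rightarrow> real" and Q' :: "'w::real_vector \<Rightarrow> real"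
  assumes G: "universal_conformal_geometry d (Q, P, L)" and G': "universal_conformal_geometry d (Q', P', L')"
    and sig: "has_signature Q k l" "has_signature Q' k l" and ne: "P \<noteq> L" "P' \<noteq> L'"
    and norms: "proj_norm Q' P' = proj_norm Q P" "proj_norm Q' L' = proj_norm Q L"
  shows "similar_geometries 1 (Q, P, L) (Q', P', L')"
proof -
  obtain u v where uv: "u \<noteq> 0" "v \<noteq> 0" "P = span {u}" "L = span {v}" "polar_form Q u v = 0"
    "proj_norm Q P = sgn (Q u)" "proj_norm Q L = sgn (Q v)" "nondegenerate_form Q" "quadratic_form Q"
    using G by (rule geometry_vectorsE)
  obtain u' v' where uv': "u' \<noteq> 0" "v' \<noteq> 0" "P' = span {u'}" "L' = span {v'}" "polar_form Q' u' v' = 0"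
    "proj_norm Q' P' = sgn (Q' u')" "proj_norm Q' L' = sgn (Q' v')" "nondegenerate_form Q'" "quadratic_form Q'"
    using G' by (rule geometry_vectorsE)
  obtain g where g: "isometry Q Q' g"
    using has_signature_isometry[OF uv(8) uv'(9) sig] by blast
  have lin: "linear g" and inj: "inj g" and gQ: "Q' (g x) = Q x" for x
    using g by (auto simp: isometry_def bij_is_inj)
  have gu: "g ` P = span {g u}" "g ` L = span {g v}"
    using uv by (simp_all add: isometry_span_singleton[OF g])
  have "span {g u} \<noteq> span {g v}"
    using ne(1) inj_image_eq_iff[OF inj] by (metis gu)
  moreover have "g u \<noteq> 0" "g v \<noteq> 0" using uv inj lin by (metis injD linear_0)+
  moreover have "polar_form Q' (g u) (g v) = 0" using isometry_polar_form[OF g] uv(5) by simp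
  ultimately have "\<exists>f. isometry Q' Q' f \<and> f ` span {g u} = span {u'} \<and> f ` span {g v} = span {v'}"
    using uv uv' ne norms by (intro transport_pair[OF uv'(8)]) (simp_all add: gQ)
  then obtain f where f: "isometry Q' Q' f" "f ` span {g u} = P'" "f ` span {g v} = L'"
    using uv' by blast
  have "(f \<circ> g) ` P = P'" "(f \<circ> g) ` L = L'"
    by (simp_all only: image_comp[symmetric] gu f)
  with isometry_compose[OF g f(1)] show ?thesis
    unfolding isometry_def by (auto intro!: exI[of _ "f \<circ> g"])
qed

lemma similarity_isometry:
  assumes f: "linear f" "bij f" "\<forall>v. Q' (f v) = c * Q v" and c: "c > 0" and Q': "quadratic_form Q'"
  shows "isometry Q Q' (\<lambda>v. (1 / sqrt c) *\<^sub>R f v)"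
proof -
  have "bij (\<lambda>v. (1 / sqrt c) *\<^sub>R f v)"
  proof (rule bijI)
    show "inj (\<lambda>v. (1 / sqrt c) *\<^sub>R f v)"
      using c bij_is_inj[OF f(2)] by (auto simp: inj_def)
    show "surj (\<lambda>v. (1 / sqrt c) *\<^sub>R f v)"
    proof (rule surjI)
      fix w
      show "(1 / sqrt c) *\<^sub>R f (inv f (sqrt c *\<^sub>R w)) = w"
        using c by (simp add: surj_f_inv_f[OF bij_is_surj[OF f(2)]])
    qed
  qed
  then show ?thesis
    using f c linear_compose_scale_right[OF f(1)]
    by (simp add: isometry_def form_scaleR[OF Q'] power_divide)
qed

lemma similar_geometries_invariants_pos:
  fixes Q :: "'v::real_vector \<Rightarrow> real" and Q' :: "'w::real_vector \<Rightarrow> real"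
  assumes G: "universal_conformal_geometry d (Q, P, L)" and G': "universal_conformal_geometry d (Q', P', L')"
    and sig: "has_signature Q k l" and sim: "similar_geometries c (Q, P, L) (Q', P', L')" and c: "c > 0"
  shows "has_signature Q' k l \<and> proj_norm Q' P' = proj_norm Q P \<and> proj_norm Q' L' = proj_norm Q L"
proof -
  obtain f where f: "linear f" "bij f" "\<forall>v. Q' (f v) = c * Q v" "f ` P = P'" "f ` L = L'"
    using sim by auto
  obtain u v where uv: "u \<noteq> 0" "v \<noteq> 0" "P = span {u}" "L = span {v}" "polar_form Q u v = 0"
    "proj_norm Q P = sgn (Q u)" "proj_norm Q L = sgn (Q v)" "nondegenerate_form Q" "quadratic_form Q"
    using G by (rule geometry_vectorsE)
  have Q': "quadratic_form Q'" using G' by (simp add: nondegenerate_form_quadratic)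
  have nz: "f u \<noteq> 0" "f v \<noteq> 0" using uv bij_is_inj[OF f(2)] f(1) by (metis injD linear_0)+
  have im: "P' = span {f u}" "L' = span {f v}"
    using linear_span_image[OF f(1), of "{u}"] linear_span_image[OF f(1), of "{v}"] f(4,5) uv(3,4) by simp_all
  have "proj_norm Q' P' = sgn (Q' (f u))" "proj_norm Q' L' = sgn (Q' (f v))"
    by (simp_all add: im proj_norm_span[OF Q'] nz)
  then have "proj_norm Q' P' = proj_norm Q P" "proj_norm Q' L' = proj_norm Q L"
    using c by (simp_all add: uv(6,7) f(3) sgn_mult)
  then show ?thesis
    using isometry_has_signature[OF similarity_isometry[OF f(1-3) c Q'] uv(9) Q' sig] by simp
qed

lemma similar_geometries_neg:
  "similar_geometries c (Q, P, L) (Q', P', L') \<longleftrightarrow> similar_geometries (- c) (\<lambda>v. - Q v, P, L) (Q', P', L')"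
  by simp

lemma isomorphic_geometries_invariants:
  fixes Q :: "'v::real_vector \<Rightarrow> real" and Q' :: "'w::real_vector \<Rightarrow> real"
  assumes G: "universal_conformal_geometry d (Q, P, L)" and G': "universal_conformal_geometry d (Q', P', L')"
    and sig: "has_signature Q k l" "has_signature Q' k' l'"
    and iso: "isomorphic_geometries (Q, P, L) (Q', P', L')"
  shows "(k', proj_norm Q' P', proj_norm Q' L') = (k, proj_norm Q P, proj_norm Q L) \<or>
    (k', proj_norm Q' P', proj_norm Q' L') = (l, - proj_norm Q P, - proj_norm Q L)"
proof -
  have Q: "quadratic_form Q" and Q': "quadratic_form Q'"
    using G G' by (auto simp: nondegenerate_form_quadratic)
  obtain c where c: "c \<noteq> 0" "similar_geometries c (Q, P, L) (Q', P', L')"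
    using iso by (auto simp: isomorphic_geometries_def)
  show ?thesis
  proof (cases "c > 0")
    case True
    with similar_geometries_invariants_pos[OF G G' sig(1) c(2)] has_signature_unique[OF Q' sig(2)]
    show ?thesis by auto
  next
    case False
    with c(1) have "- c > 0" by simp
    from similar_geometries_invariants_pos[OF universal_conformal_geometry_neg(1)[OF G] G'
        has_signature_neg[OF Q sig(1)] c(2)[unfolded similar_geometries_neg[of c]] this]
    show ?thesis
      using has_signature_unique[OF Q' sig(2)] universal_conformal_geometry_neg(2,3)[OF G] by auto
  qed
qed

lemma isomorphic_geometries_of_norms:
  fixes Q :: "'v::real_vector \<Rightarrow> real" and Q' :: "'w::real_vector \<Rightarrow> real"
  assumes G: "universal_conformal_geometry d (Q, P, L)" and G': "universal_conformal_geometry d (Q', P', L')"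
    and sig: "has_signature Q k l" "has_signature Q' k' l'" and ne: "P \<noteq> L" "P' \<noteq> L'"
    and inv: "(k', proj_norm Q' P', proj_norm Q' L') = (k, proj_norm Q P, proj_norm Q L) \<or>
      (k', proj_norm Q' P', proj_norm Q' L') = (l, - proj_norm Q P, - proj_norm Q L)"
  shows "isomorphic_geometries (Q, P, L) (Q', P', L')"
proof -
  have Q: "quadratic_form Q" using G by (auto simp: nondegenerate_form_quadratic)
  have dims: "k + l = k' + l'"
    using has_signature_dim[OF sig(1)] has_signature_dim[OF sig(2)] G G' by simp
  from inv show ?thesis
  proof
    assume "(k', proj_norm Q' P', proj_norm Q' L') = (k, proj_norm Q P, proj_norm Q L)"
    then have "similar_geometries 1 (Q, P, L) (Q', P', L')"
      using similar_geometries_of_norms[OF G G' sig(1) _ ne] sig(2) dims by simp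
    then show ?thesis unfolding isomorphic_geometries_def by (intro exI[of _ 1]) simp
  next
    assume *: "(k', proj_norm Q' P', proj_norm Q' L') = (l, - proj_norm Q P, - proj_norm Q L)"
    have "similar_geometries 1 (\<lambda>v. - Q v, P, L) (Q', P', L')"
      using similar_geometries_of_norms[OF universal_conformal_geometry_neg(1)[OF G] G'
          has_signature_neg[OF Q sig(1)] _ ne] sig(2) dims * universal_conformal_geometry_neg(2,3)[OF G]
      by simp
    then have "similar_geometries (-1) (Q, P, L) (Q', P', L')"
      by (subst similar_geometries_neg) simp
    then show ?thesis unfolding isomorphic_geometries_def by (intro exI[of _ "-1"]) simp
  qed
qed

section \<open>Non-degenerate geometries\<close>

lemma nondegenerate_geometry_iff_vectors:
  assumes Q: "quadratic_form Q"
  shows "nondegenerate_geometry (Q, span {u}, span {v}) \<longleftrightarrow>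
    (\<exists>p h. Q p = 0 \<and> Q h = 0 \<and> polar_form Q p h = 0 \<and> polar_form Q u p = 0 \<and> polar_form Q v p \<noteq> 0 \<and>
           polar_form Q v h = 0 \<and> polar_form Q u h \<noteq> 0)" (is "?L \<longleftrightarrow> ?R")
proof
  have null: "(\<forall>x\<in>span {p}. Q x = 0) \<longleftrightarrow> Q p = 0" for p
    by (auto simp: span_singleton form_scaleR[OF Q])
  show ?R if ?L
  proof -
    obtain P H where PH: "P \<in> proj_space" "H \<in> proj_space" "\<forall>x\<in>P. Q x = 0" "\<forall>x\<in>H. Q x = 0"
      "proj_orthogonal Q P H" "proj_orthogonal Q (span {u}) P" "\<not> proj_orthogonal Q (span {v}) P"
      "proj_orthogonal Q (span {v}) H" "\<not> proj_orthogonal Q (span {u}) H"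
      using \<open>?L\<close> by (auto simp: ideal_hypercycle_def)
    obtain p h where "P = span {p}" "H = span {h}" using PH by (metis proj_spaceE)
    with PH show ?R by (auto simp: proj_orthogonal_span[OF Q] null)
  qed
  assume ?R
  then obtain p h where ph: "Q p = 0" "Q h = 0" "polar_form Q p h = 0" "polar_form Q u p = 0"
    "polar_form Q v p \<noteq> 0" "polar_form Q v h = 0" "polar_form Q u h \<noteq> 0" by blast
  then have "p \<noteq> 0" "h \<noteq> 0" by (auto simp: polar_form_simps[OF Q])
  with ph show ?L
    unfolding nondegenerate_geometry.simps
    by - (rule exI[of _ "span {p}"], rule exI[of _ "span {h}"],
      simp add: ideal_hypercycle_def proj_orthogonal_span[OF Q] null span_singleton_in_proj_space)
qed

text \<open>With at most one negative direction, some combination of the two vectors lies in the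
  positive definite part, where only 0 is isotropic.\<close>

lemma lorentzian_isotropic_dependent:
  assumes Q: "quadratic_form Q" and F: "orthonormal_frame Q A C" "span (A \<union> C) = UNIV" and "card C \<le> 1"
    and ph: "Q p = 0" "Q h = 0" "polar_form Q p h = 0"
  shows "\<exists>a b. (a \<noteq> 0 \<or> b \<noteq> 0) \<and> a *\<^sub>R p + b *\<^sub>R h = 0"
proof -
  have fin: "finite A" "finite C" using F by (auto simp: orthonormal_frame_def)
  have zero: "x = 0" if x: "Q x = 0" "\<forall>c\<in>C. polar_form Q x c = 0" for x
  proof -
    have "x \<in> span (A \<union> C)" by (simp add: F)
    then obtain t where t: "x = (\<Sum>y\<in>A\<union>C. t y *\<^sub>R y)"
      using span_finite[of "A \<union> C"] fin by auto
    have tC: "t c = 0" if "c \<in> C" for c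
      using orthonormal_frame_polar_form_sum[OF Q F(1), of c t] x(2) that F(1)
      by (simp add: orthonormal_frame_def flip: t)
    have "Q x = (\<Sum>y\<in>A\<union>C. (t y)\<^sup>2 * Q y)"
      unfolding t using F(1)
      by (intro form_orthogonal_sum[OF Q]) (auto simp: orthonormal_frame_def)
    also have "\<dots> = (\<Sum>y\<in>A\<union>C. (t y)\<^sup>2)"
      using F(1) tC by (intro sum.cong) (auto simp: orthonormal_frame_def)
    finally have "\<forall>y\<in>A\<union>C. t y = 0" using x(1) fin by (simp add: sum_nonneg_eq_0_iff)
    then show ?thesis by (simp add: t)
  qed
  show ?thesis
  proof (cases "\<forall>c\<in>C. polar_form Q p c = 0")
    case True
    then have "p = 0" using zero ph(1) by blast
    then show ?thesis by (intro exI[of _ 1] exI[of _ 0]) simp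
  next
    case False
    then obtain c where c: "c \<in> C" "polar_form Q p c \<noteq> 0" by blast
    have C: "c' = c" if "c' \<in> C" for c'
      using that c(1) \<open>card C \<le> 1\<close> card_le_Suc0_iff_eq[OF fin(2)] by auto
    let ?a = "polar_form Q h c" and ?b = "- polar_form Q p c"
    have "Q (?a *\<^sub>R p + ?b *\<^sub>R h) = 0"
      using ph by (simp add: form_diff[OF Q] form_scaleR[OF Q] polar_form_simps[OF Q])
    moreover have "\<forall>c'\<in>C. polar_form Q (?a *\<^sub>R p + ?b *\<^sub>R h) c' = 0"
      using C by (auto simp: polar_form_simps[OF Q])
    ultimately have "?a *\<^sub>R p + ?b *\<^sub>R h = 0" by (rule zero)
    then show ?thesis using c(2) by (intro exI[of _ ?a] exI[of _ ?b]) simp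
  qed
qed

lemma isotropic_dependent:
  assumes Q: "quadratic_form Q" and sig: "has_signature Q k l" and "k \<le> 1 \<or> l \<le> 1"
    and ph: "Q p = 0" "Q h = 0" "polar_form Q p h = 0"
  shows "\<exists>a b. (a \<noteq> 0 \<or> b \<noteq> 0) \<and> a *\<^sub>R p + b *\<^sub>R h = 0"
proof -
  obtain A C where F: "orthonormal_frame Q A C" "span (A \<union> C) = UNIV" "card A = k" "card C = l"
    using sig Q by (auto simp: has_signature_iff_frame)
  from assms(3) show ?thesis
  proof
    assume "l \<le> 1"
    then show ?thesis using lorentzian_isotropic_dependent[OF Q F(1,2) _ ph] F(4) by simp
  next
    assume "k \<le> 1"
    moreover have "polar_form (\<lambda>v. - Q v) p h = 0" using ph(3) by (simp add: polar_form_def)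
    ultimately show ?thesis
      using lorentzian_isotropic_dependent[OF quadratic_form_neg[OF Q] orthonormal_frame_neg[OF F(1)], of p h]
        F ph by (simp add: Un_commute)
  qed
qed

lemma nondegenerate_geometry_imp:
  assumes G: "universal_conformal_geometry d (Q, P, L)" and sig: "has_signature Q k l"
    and nd: "nondegenerate_geometry (Q, P, L)"
  shows "2 \<le> k" "2 \<le> l" "P \<noteq> L"
proof -
  obtain u v where uv: "u \<noteq> 0" "v \<noteq> 0" "P = span {u}" "L = span {v}" "polar_form Q u v = 0"
    "proj_norm Q P = sgn (Q u)" "proj_norm Q L = sgn (Q v)" "nondegenerate_form Q" "quadratic_form Q"
    using G by (rule geometry_vectorsE)
  note Q = uv(9)
  obtain p h where ph: "Q p = 0" "Q h = 0" "polar_form Q p h = 0" "polar_form Q u p = 0"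
    "polar_form Q v p \<noteq> 0" "polar_form Q v h = 0" "polar_form Q u h \<noteq> 0"
    using nd nondegenerate_geometry_iff_vectors[OF Q] uv by auto
  have indep: "a = 0 \<and> b = 0" if "a *\<^sub>R p + b *\<^sub>R h = 0" for a b
  proof -
    have "polar_form Q u (a *\<^sub>R p + b *\<^sub>R h) = 0" "polar_form Q v (a *\<^sub>R p + b *\<^sub>R h) = 0"
      unfolding that by (simp_all add: polar_form_simps[OF Q])
    with ph show ?thesis by (simp add: polar_form_simps[OF Q])
  qed
  have "\<not> (k \<le> 1 \<or> l \<le> 1)"
    using isotropic_dependent[OF Q sig _ ph(1-3)] indep by blast
  then show "2 \<le> k" "2 \<le> l" by auto
  show "P \<noteq> L"
  proof
    assume "P = L"
    then have "v \<in> span {u}" using uv(3,4) span_base[of v "{v}"] by simp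
    then obtain r where "v = r *\<^sub>R u" by (auto simp: span_singleton)
    with ph show False by (simp add: polar_form_simps[OF Q])
  qed
qed

lemma standard_pair_exists:
  fixes Q :: "'v::real_vector \<Rightarrow> real" and s t :: real
  assumes Q: "quadratic_form Q" and sig: "has_signature Q k l" "2 \<le> k" "2 \<le> l"
    and st: "s \<in> {1, 0, -1}" "t \<in> {1, 0, -1}"
  shows "\<exists>u v. u \<noteq> 0 \<and> v \<noteq> 0 \<and> polar_form Q u v = 0 \<and> sgn (Q u) = s \<and> sgn (Q v) = t \<and>
    nondegenerate_geometry (Q, span {u}, span {v})"
proof -
  obtain A C where F: "orthonormal_frame Q A C" "span (A \<union> C) = UNIV" "card A = k" "card C = l"
    using sig Q by (auto simp: has_signature_iff_frame)
  have fin: "finite A" "finite C" using F by (auto simp: orthonormal_frame_def)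
  obtain a a' where a: "a \<in> A" "a' \<in> A" "a \<noteq> a'"
    using card_le_Suc0_iff_eq[OF fin(1)] F(3) sig(2) by fastforce
  obtain c c' where c: "c \<in> C" "c' \<in> C" "c \<noteq> c'"
    using card_le_Suc0_iff_eq[OF fin(2)] F(4) sig(3) by fastforce
  have one: "Q a = 1" "Q a' = 1" "Q c = -1" "Q c' = -1"
    using F(1) a c by (auto simp: orthonormal_frame_def)
  then have ne: "a \<noteq> c" "a \<noteq> c'" "a' \<noteq> c" "a' \<noteq> c'" by auto
  have z: "polar_form Q x y = 0" if "x \<in> A \<union> C" "y \<in> A \<union> C" "x \<noteq> y" for x y
    using F(1) that unfolding orthonormal_frame_def by blast
  have p0: "polar_form Q a a' = 0" "polar_form Q a' a = 0" "polar_form Q c c' = 0" "polar_form Q c' c = 0"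
    "polar_form Q a c = 0" "polar_form Q c a = 0" "polar_form Q a c' = 0" "polar_form Q c' a = 0"
    "polar_form Q a' c = 0" "polar_form Q c a' = 0" "polar_form Q a' c' = 0" "polar_form Q c' a' = 0"
    using a c ne by (auto intro!: z)
  define u where "u = (if s \<ge> 0 then a else 0) + (if s \<le> 0 then c else 0)"
  define v where "v = (if t \<ge> 0 then a' else 0) + (if t \<le> 0 then c' else 0)"
  note simps = u_def v_def form_add[of Q] form_diff[OF Q] form_zero[OF Q] polar_form_simps[OF Q]
    polar_form_self[OF Q] one p0
  have "sgn (Q u) = s" "sgn (Q v) = t" "polar_form Q u v = 0" using st by (auto simp: simps)
  moreover have ph: "Q (a' - c') = 0" "Q (a - c) = 0" "polar_form Q (a' - c') (a - c) = 0"
      "polar_form Q u (a' - c') = 0" "polar_form Q v (a' - c') \<noteq> 0"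
      "polar_form Q v (a - c) = 0" "polar_form Q u (a - c) \<noteq> 0"
    using st by (auto simp: simps)
  moreover have "u \<noteq> 0" "v \<noteq> 0" using ph by (auto simp: polar_form_simps[OF Q])
  ultimately show ?thesis unfolding nondegenerate_geometry_iff_vectors[OF Q] by blast
qed

lemma standard_geometry_exists:
  fixes Q :: "'v::real_vector \<Rightarrow> real" and s t :: real
  assumes N: "nondegenerate_form Q" and dim: "dim (UNIV :: 'v set) = d + 3"
    and sig: "has_signature Q k l" "2 \<le> k" "2 \<le> l"
    and st: "s \<in> {1, 0, -1}" "t \<in> {1, 0, -1}"
  shows "\<exists>P L. universal_conformal_geometry d (Q, P, L) \<and> nondegenerate_geometry (Q, P, L) \<and>
    proj_norm Q P = s \<and> proj_norm Q L = t"
proof -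
  note Q = nondegenerate_form_quadratic[OF N]
  obtain u v where "u \<noteq> 0" "v \<noteq> 0" "polar_form Q u v = 0" "sgn (Q u) = s" "sgn (Q v) = t"
    "nondegenerate_geometry (Q, span {u}, span {v})"
    using standard_pair_exists[OF Q sig st] by blast
  then show ?thesis using N dim
    by (intro exI[of _ "span {u}"] exI[of _ "span {v}"])
       (simp add: proj_orthogonal_span[OF Q] proj_norm_span[OF Q] span_singleton_in_proj_space
         del: nondegenerate_geometry.simps)
qed

lemma similar_nondegenerate_geometry:
  fixes Q Q' :: "'v::real_vector \<Rightarrow> real"
  assumes G: "universal_conformal_geometry d (Q, P, L)" and G': "universal_conformal_geometry d (Q', P', L')"
    and sim: "similar_geometries 1 (Q, P, L) (Q', P', L')" and nd: "nondegenerate_geometry (Q, P, L)"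
  shows "nondegenerate_geometry (Q', P', L')"
proof -
  obtain f where f: "isometry Q Q' f" "f ` P = P'" "f ` L = L'"
    using sim by (auto simp: isometry_def)
  obtain u v where uv: "u \<noteq> 0" "v \<noteq> 0" "P = span {u}" "L = span {v}" "polar_form Q u v = 0"
    "proj_norm Q P = sgn (Q u)" "proj_norm Q L = sgn (Q v)" "nondegenerate_form Q" "quadratic_form Q"
    using G by (rule geometry_vectorsE)
  have Q': "quadratic_form Q'" using G' by (simp add: nondegenerate_form_quadratic)
  obtain p h where ph: "Q p = 0" "Q h = 0" "polar_form Q p h = 0" "polar_form Q u p = 0"
    "polar_form Q v p \<noteq> 0" "polar_form Q v h = 0" "polar_form Q u h \<noteq> 0"
    using nd nondegenerate_geometry_iff_vectors[OF uv(9)] uv by auto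
  have fQ: "Q' (f x) = Q x" for x using f(1) by (simp add: isometry_def)
  have "P' = span {f u}" "L' = span {f v}" using f uv by (simp_all add: isometry_span_singleton[OF f(1)])
  moreover have "nondegenerate_geometry (Q', span {f u}, span {f v})"
    unfolding nondegenerate_geometry_iff_vectors[OF Q'] using ph
    by (intro exI[of _ "f p"] exI[of _ "f h"]) (simp add: fQ isometry_polar_form[OF f(1)])
  ultimately show ?thesis by simp
qed

text \<open>By Witt's theorem it suffices to exhibit one non-degenerate pair for every pair of norms.\<close>

lemma nondegenerate_geometry_iff:
  fixes Q :: "'v::real_vector \<Rightarrow> real"
  assumes G: "universal_conformal_geometry d (Q, P, L)" and sig: "has_signature Q k l"
  shows "nondegenerate_geometry (Q, P, L) \<longleftrightarrow> 2 \<le> k \<and> 2 \<le> l \<and> P \<noteq> L"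
proof
  assume "nondegenerate_geometry (Q, P, L)"
  from nondegenerate_geometry_imp[OF G sig this] show "2 \<le> k \<and> 2 \<le> l \<and> P \<noteq> L" by blast
next
  assume kl: "2 \<le> k \<and> 2 \<le> l \<and> P \<noteq> L"
  have N: "nondegenerate_form Q" and dim: "dim (UNIV :: 'v set) = d + 3" using G by auto
  obtain P0 L0 where G0: "universal_conformal_geometry d (Q, P0, L0)" "nondegenerate_geometry (Q, P0, L0)"
    and n: "proj_norm Q P0 = proj_norm Q P" "proj_norm Q L0 = proj_norm Q L"
    using standard_geometry_exists[OF N dim sig] kl proj_norm_in[OF G] by blast
  have "P0 \<noteq> L0" using nondegenerate_geometry_imp[OF G0(1) sig G0(2)] by blast
  then have "similar_geometries 1 (Q, P0, L0) (Q, P, L)"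
    using similar_geometries_of_norms[OF G0(1) G sig sig] kl n by simp
  from similar_nondegenerate_geometry[OF G0(1) G this G0(2)] show "nondegenerate_geometry (Q, P, L)" .
qed

section \<open>Counting isomorphism classes\<close>

lemma geometry_classes_by_invariant:
  assumes "\<And>G G'. G \<in> S \<Longrightarrow> G' \<in> S \<Longrightarrow> R G G' \<longleftrightarrow> F G = F G'"
  shows "card (geometry_classes R S) = card (F ` S)"
    and "finite (F ` S) \<Longrightarrow> finite (geometry_classes R S)"
proof -
  let ?fib = "\<lambda>y. {G \<in> S. F G = y}"
  have "{(G, G'). G \<in> S \<and> G' \<in> S \<and> R G G'} `` {G} = ?fib (F G)" if "G \<in> S" for G
  proof (rule set_eqI)
    fix x
    show "x \<in> {(G, G'). G \<in> S \<and> G' \<in> S \<and> R G G'} `` {G} \<longleftrightarrow> x \<in> ?fib (F G)"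
      using assms[OF that, of x] that by auto
  qed
  then have eq: "geometry_classes R S = ?fib ` (F ` S)"
    unfolding geometry_classes_def quotient_def image_image by (auto simp: image_iff)
  have "inj_on ?fib (F ` S)" by (intro inj_onI) blast
  then show "card (geometry_classes R S) = card (F ` S)" unfolding eq by (rule card_image)
  show "finite (geometry_classes R S)" if "finite (F ` S)" using that unfolding eq by simp
qed

lemma card_orbits_involution:
  assumes fin: "finite X" and \<sigma>: "\<And>x. x \<in> X \<Longrightarrow> \<sigma> x \<in> X" "\<And>x. x \<in> X \<Longrightarrow> \<sigma> (\<sigma> x) = x"
  shows "2 * card ((\<lambda>x. {x, \<sigma> x}) ` X) = card X + card {x \<in> X. \<sigma> x = x}"
proof -
  let ?I = "(\<lambda>x. {x, \<sigma> x}) ` X"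
  have "card (\<Union>?I) = sum card ?I"
  proof (rule card_Union_disjoint)
    show "pairwise disjnt ?I"
      unfolding pairwise_def disjnt_def using \<sigma>(2) by (auto; metis)
  qed auto
  moreover have "\<Union>?I = X" using \<sigma>(1) by auto
  ultimately have X: "card X = sum card ?I" by simp
  have "card {x \<in> X. \<sigma> x = x} = card ((\<lambda>x. {x}) ` {x \<in> X. \<sigma> x = x})"
    by (simp add: card_image)
  also have "(\<lambda>x. {x}) ` {x \<in> X. \<sigma> x = x} = {c \<in> ?I. card c = 1}"
    by (auto simp: card_1_singleton_iff)
  also have "card \<dots> = (\<Sum>c\<in>?I. if card c = 1 then 1 else 0)"
    using fin by (simp add: sum.If_cases Int_def)
  finally have "card X + card {x \<in> X. \<sigma> x = x} = (\<Sum>c\<in>?I. card c + (if card c = 1 then 1 else 0))"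
    by (simp add: X sum.distrib)
  also have "\<dots> = (\<Sum>c\<in>?I. 2)"
    by (intro sum.cong) (auto simp: card_insert_if)
  finally show ?thesis by simp
qed

definition flip_signs :: "nat \<Rightarrow> nat \<times> real \<times> real \<Rightarrow> nat \<times> real \<times> real" where
  "flip_signs n = (\<lambda>(k, s, t). (n - k, - s, - t))"

fun geometry_type :: "'v::real_vector geometry \<Rightarrow> nat \<times> real \<times> real" where
  "geometry_type (Q, P, L) = ((THE k. \<exists>l. has_signature Q k l), proj_norm Q P, proj_norm Q L)"

lemma geometry_type_eq:
  assumes "universal_conformal_geometry d (Q, P, L)" "has_signature Q k l"
  shows "geometry_type (Q, P, L) = (k, proj_norm Q P, proj_norm Q L)"
proof -
  have "quadratic_form Q" using assms(1) by (simp add: nondegenerate_form_quadratic)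
  then have "(THE k. \<exists>l. has_signature Q k l) = k"
    using assms(2) has_signature_unique(1) by (intro the_equality) blast+
  then show ?thesis by simp
qed

lemma geometry_has_signatureE:
  assumes "universal_conformal_geometry d (Q :: 'v::real_vector \<Rightarrow> real, P, L)"
  obtains k l where "has_signature Q k l" "k + l = d + 3"
proof -
  have "nondegenerate_form Q" "dim (UNIV :: 'v set) = d + 3" using assms by auto
  then obtain k l where "has_signature Q k l" using has_signature_exists[of Q] by auto
  then show thesis using that has_signature_dim[of Q k l] \<open>dim _ = _\<close> by simp
qed

definition geometry_types :: "nat \<Rightarrow> (nat \<times> real \<times> real) set" where
  "geometry_types d = {2..d + 1} \<times> {1, 0, -1} \<times> {1, 0, -1}"

lemma geometry_types_iff:
  "(k, s, t) \<in> geometry_types d \<longleftrightarrow> 2 \<le> k \<and> k \<le> d + 1 \<and> s \<in> {1, 0, -1} \<and> t \<in> {1, 0, -1}"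
  unfolding geometry_types_def mem_Times_iff by simp

lemma finite_geometry_types: "finite (geometry_types d)"
  unfolding geometry_types_def by (intro finite_cartesian_product) auto

lemma flip_signs_geometry_types:
  assumes "x \<in> geometry_types d"
  shows "flip_signs (d + 3) x \<in> geometry_types d" "flip_signs (d + 3) (flip_signs (d + 3) x) = x"
proof -
  obtain k s t where x: "x = (k, s, t)" by (cases x)
  show "flip_signs (d + 3) x \<in> geometry_types d" "flip_signs (d + 3) (flip_signs (d + 3) x) = x"
    using assms unfolding x flip_signs_def prod.case geometry_types_iff by auto
qed

lemma card_geometry_type_orbits:
  "2 * card ((\<lambda>x. {x, flip_signs (d + 3) x}) ` geometry_types d) = 9 * d + (if odd d then 1 else 0)"
proof -
  have "{x \<in> geometry_types d. flip_signs (d + 3) x = x} = (if odd d then {((d + 3) div 2, 0, 0)} else {})"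
  proof -
    have k: "2 \<le> k \<and> k \<le> d + 1 \<and> d + 3 - k = k \<longleftrightarrow> odd d \<and> k = (d + 3) div 2" for k
      by presburger
    have "x \<in> geometry_types d \<and> flip_signs (d + 3) x = x \<longleftrightarrow> odd d \<and> x = ((d + 3) div 2, 0, 0)" for x
      using k[of "fst x"] by (cases x) (auto simp: geometry_types_iff flip_signs_def)
    then show ?thesis by auto
  qed
  moreover have "card ({1, 0, -1} :: real set) = 3" by simp
  then have "card (geometry_types d) = 9 * d"
    unfolding geometry_types_def card_cartesian_product by simp
  ultimately show ?thesis
    using card_orbits_involution[OF finite_geometry_types flip_signs_geometry_types, of d] by simp
qed

context
  fixes d :: nat and S :: "'v::real_vector geometry set"
  assumes dim: "dim (UNIV :: 'v set) = d + 3"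
  defines "S \<equiv> {G. universal_conformal_geometry d G \<and> nondegenerate_geometry G}"
begin

lemma geometry_type_image: "geometry_type ` S = geometry_types d"
proof (intro equalityI subsetI)
  fix x assume "x \<in> geometry_type ` S"
  then obtain Y where Y: "Y \<in> S" "x = geometry_type Y" by blast
  obtain Q P L where Y_eq: "Y = (Q, P, L)" by (cases Y)
  have x: "x = geometry_type (Q, P, L)" and G: "universal_conformal_geometry d (Q, P, L)"
    "nondegenerate_geometry (Q, P, L)" using Y by (simp_all only: S_def Y_eq mem_Collect_eq)
  obtain k l where kl: "has_signature Q k l" "k + l = d + 3" using G(1) by (rule geometry_has_signatureE)
  show "x \<in> geometry_types d"
    unfolding x geometry_type_eq[OF G(1) kl(1)] geometry_types_iff
    using nondegenerate_geometry_imp[OF G(1) kl(1) G(2)] kl(2) proj_norm_in[OF G(1)] by simp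
next
  fix x assume "x \<in> geometry_types d"
  then obtain k s t where x: "x = (k, s, t)" "2 \<le> k" "k \<le> d + 1" "s \<in> {1, 0, -1}" "t \<in> {1, 0, -1}"
    by (cases x) (simp only: geometry_types_iff)
  have l: "2 \<le> d + 3 - k" using x(3) by simp
  obtain Q :: "'v \<Rightarrow> real" where Q: "nondegenerate_form Q" "has_signature Q k (d + 3 - k)"
    using form_with_signature_exists[where 'v='v, of k "d + 3 - k"] dim x by auto
  obtain P L where G: "universal_conformal_geometry d (Q, P, L)" "nondegenerate_geometry (Q, P, L)"
    "proj_norm Q P = s" "proj_norm Q L = t"
    using standard_geometry_exists[OF Q(1) dim Q(2) x(2) _ x(4,5)] l by blast
  have "x = geometry_type (Q, P, L)" unfolding geometry_type_eq[OF G(1) Q(2)] using G x by simp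
  then show "x \<in> geometry_type ` S" using G unfolding S_def by blast
qed

lemma isomorphic_iff_geometry_type:
  assumes "G \<in> S" "G' \<in> S"
  shows "isomorphic_geometries G G' \<longleftrightarrow>
    geometry_type G' \<in> {geometry_type G, flip_signs (d + 3) (geometry_type G)}"
proof -
  obtain Q P L where G_eq: "G = (Q, P, L)" by (cases G)
  obtain Q' P' L' where G'_eq: "G' = (Q', P', L')" by (cases G')
  have G: "universal_conformal_geometry d (Q, P, L)" "nondegenerate_geometry (Q, P, L)"
    and G': "universal_conformal_geometry d (Q', P', L')" "nondegenerate_geometry (Q', P', L')"
    using assms by (simp_all only: S_def G_eq G'_eq mem_Collect_eq)
  obtain k l where kl: "has_signature Q k l" "k + l = d + 3" using G(1) by (rule geometry_has_signatureE)
  obtain k' l' where kl': "has_signature Q' k' l'" "k' + l' = d + 3" using G'(1) by (rule geometry_has_signatureE)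
  have ne: "P \<noteq> L" "P' \<noteq> L'"
    using nondegenerate_geometry_imp[OF G(1) kl(1) G(2)] nondegenerate_geometry_imp[OF G'(1) kl'(1) G'(2)]
    by blast+
  have l: "d + 3 - k = l" using kl(2) by simp
  show ?thesis
    unfolding G_eq G'_eq geometry_type_eq[OF G(1) kl(1)] geometry_type_eq[OF G'(1) kl'(1)]
      flip_signs_def prod.case l insert_iff empty_iff
    using isomorphic_geometries_invariants[OF G(1) G'(1) kl(1) kl'(1)]
      isomorphic_geometries_of_norms[OF G(1) G'(1) kl(1) kl'(1) ne] by blast
qed

lemma count_nondegenerate_geometries:
  "finite (geometry_classes isomorphic_geometries S)"
  "2 * card (geometry_classes isomorphic_geometries S) = 9 * d + (if odd d then 1 else 0)"
proof -
  let ?F = "\<lambda>G. {geometry_type G, flip_signs (d + 3) (geometry_type G)}"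
  have "isomorphic_geometries G G' \<longleftrightarrow> ?F G = ?F G'" if GG: "G \<in> S" "G' \<in> S" for G G'
  proof -
    have "geometry_type G \<in> geometry_types d" "geometry_type G' \<in> geometry_types d"
      using GG geometry_type_image by blast+
    then show ?thesis
      unfolding isomorphic_iff_geometry_type[OF GG] using flip_signs_geometry_types(2)
      by (metis doubleton_eq_iff insert_iff singletonD)
  qed
  note classes = geometry_classes_by_invariant[of S isomorphic_geometries ?F, OF this]
  have im: "?F ` S = (\<lambda>x. {x, flip_signs (d + 3) x}) ` geometry_types d"
    unfolding geometry_type_image[symmetric] image_image ..
  show "finite (geometry_classes isomorphic_geometries S)"
    by (rule classes(2)) (simp_all only: im finite_imageI finite_geometry_types)
  show "2 * card (geometry_classes isomorphic_geometries S) = 9 * d + (if odd d then 1 else 0)"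
    using card_geometry_type_orbits classes(1) by (simp only: im)
qed

end

lemma nine_classes_of_fixed_form:
  fixes Q :: "'v::real_vector \<Rightarrow> real"
  assumes N: "nondegenerate_form Q" and dim: "dim (UNIV :: 'v set) = d + 3"
    and sig: "has_signature Q k l" "2 \<le> k" "2 \<le> l"
  shows "{(proj_norm Q P, proj_norm Q L) | P L.
      universal_conformal_geometry d (Q, P, L) \<and> nondegenerate_geometry (Q, P, L)}
      = {1, 0, -1} \<times> {1, 0, -1}" (is ?norms)
    and "card (geometry_classes (similar_geometries 1)
      {(Q, P, L) | P L. universal_conformal_geometry d (Q, P, L) \<and> nondegenerate_geometry (Q, P, L)}) = 9"
      (is "card (geometry_classes _ ?S) = 9")
proof -
  show norms: ?norms
  proof (intro equalityI subsetI)
    fix x :: "real \<times> real" assume "x \<in> {1, 0, -1} \<times> {1, 0, -1}"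
    then obtain s t where x: "x = (s, t)" "s \<in> {1, 0, -1}" "t \<in> {1, 0, -1}" by blast
    obtain P L where G: "universal_conformal_geometry d (Q, P, L)" "nondegenerate_geometry (Q, P, L)"
      "proj_norm Q P = s" "proj_norm Q L = t"
      using standard_geometry_exists[OF N dim sig x(2,3)] by blast
    then have "x = (proj_norm Q P, proj_norm Q L)" by (simp only: x)
    then show "x \<in> {(proj_norm Q P, proj_norm Q L) | P L.
        universal_conformal_geometry d (Q, P, L) \<and> nondegenerate_geometry (Q, P, L)}"
      using G(1,2) by blast
  qed (use proj_norm_in in blast)
  let ?F = "\<lambda>(Q, P, L). (proj_norm Q P, proj_norm Q L)"
  have "similar_geometries 1 G G' \<longleftrightarrow> ?F G = ?F G'" if "G \<in> ?S" "G' \<in> ?S" for G G'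
  proof -
    obtain P L where G: "G = (Q, P, L)" "universal_conformal_geometry d (Q, P, L)"
      "nondegenerate_geometry (Q, P, L)" using \<open>G \<in> ?S\<close> by blast
    obtain P' L' where G': "G' = (Q, P', L')" "universal_conformal_geometry d (Q, P', L')"
      "nondegenerate_geometry (Q, P', L')" using \<open>G' \<in> ?S\<close> by blast
    have ne: "P \<noteq> L" "P' \<noteq> L'"
      using nondegenerate_geometry_imp(3)[OF G(2) sig(1) G(3)]
        nondegenerate_geometry_imp(3)[OF G'(2) sig(1) G'(3)] by auto
    show ?thesis
      unfolding G(1) G'(1)
      using similar_geometries_invariants_pos[OF G(2) G'(2) sig(1), of 1]
        similar_geometries_of_norms[OF G(2) G'(2) sig(1) sig(1) ne]
      by (auto simp del: similar_geometries.simps)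
  qed
  then have "card (geometry_classes (similar_geometries 1) ?S) = card (?F ` ?S)"
    by (rule geometry_classes_by_invariant(1))
  also have "?F ` ?S = {(proj_norm Q P, proj_norm Q L) | P L.
      universal_conformal_geometry d (Q, P, L) \<and> nondegenerate_geometry (Q, P, L)}"
    by (force simp del: universal_conformal_geometry.simps nondegenerate_geometry.simps)
  finally show "card (geometry_classes (similar_geometries 1) ?S) = 9"
    unfolding norms card_cartesian_product by simp
qed

theorem mainTheorem4:
  fixes d n :: nat
  assumes "dim (UNIV :: 'v::real_vector set) = n" and "n = d + 3"
  shows
    \<comment> \<open>the form is determined by its signature\<close>
    "(\<forall>Q :: 'v \<Rightarrow> real. nondegenerate_form Q \<longrightarrow>
        (\<exists>!kl. has_signature Q (fst kl) (snd kl)) \<and>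
        (\<forall>k l. has_signature Q k l \<longrightarrow> k + l = n)) \<and>
     (\<forall>(Q :: 'v \<Rightarrow> real) (Q' :: 'w::real_vector \<Rightarrow> real) k l.
        nondegenerate_form Q \<and> nondegenerate_form Q' \<and> has_signature Q k l \<longrightarrow>
        (has_signature Q' k l \<longleftrightarrow> isometric_forms Q Q')) \<and>
     \<comment> \<open>signatures (k,l) and (l,k) give the same geometries\<close>
     (\<forall>k l (Q :: 'v \<Rightarrow> real) P L.
        universal_conformal_geometry d (Q, P, L) \<and> has_signature Q k l \<longrightarrow>
        (\<exists>(Q' :: 'v \<Rightarrow> real) P' L'. universal_conformal_geometry d (Q', P', L') \<and>
           has_signature Q' l k \<and> isomorphic_geometries (Q, P, L) (Q', P', L'))) \<and>
     \<comment> \<open>maximal symplectic subspaces\<close>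
     (\<forall>k l (Q :: 'v \<Rightarrow> real). nondegenerate_form Q \<and> has_signature Q k l \<and> k \<ge> l \<longrightarrow>
        (\<exists>W. maximal_symplectic_subspace Q W) \<and>
        (\<forall>W. maximal_symplectic_subspace Q W \<longrightarrow> dim W = 2 * l)) \<and>
     \<comment> \<open>non-degeneracy; P = L is always degenerate\<close>
     (\<forall>k l (Q :: 'v \<Rightarrow> real) P L.
        universal_conformal_geometry d (Q, P, L) \<and> has_signature Q k l \<and> k \<ge> l \<longrightarrow>
        (nondegenerate_geometry (Q, P, L) \<longleftrightarrow> l \<ge> 2 \<and> P \<noteq> L)) \<and>
     \<comment> \<open>norms\<close>
     (\<forall>(Q :: 'v \<Rightarrow> real) P L. universal_conformal_geometry d (Q, P, L) \<longrightarrow>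
        proj_norm Q P \<in> {1, 0, -1} \<and> proj_norm Q L \<in> {1, 0, -1}) \<and>
     \<comment> \<open>the pair of norms determines the geometry unless k = l or both norms vanish\<close>
     (\<forall>k l (Q :: 'v \<Rightarrow> real) P L (Q' :: 'w \<Rightarrow> real) P' L'.
        universal_conformal_geometry d (Q, P, L) \<and> has_signature Q k l \<and>
        universal_conformal_geometry d (Q', P', L') \<and> has_signature Q' k l \<and>
        k > l \<and> \<not> (proj_norm Q P = 0 \<and> proj_norm Q L = 0) \<longrightarrow>
        (isomorphic_geometries (Q, P, L) (Q', P', L') \<longleftrightarrow>
           (proj_norm Q' P', proj_norm Q' L') = (proj_norm Q P, proj_norm Q L))) \<and>
     \<comment> \<open>for k = l both signs can be flipped\<close>
     (\<forall>l (Q :: 'v \<Rightarrow> real) P L (Q' :: 'w \<Rightarrow> real) P' L'.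
        universal_conformal_geometry d (Q, P, L) \<and> has_signature Q l l \<and>
        universal_conformal_geometry d (Q', P', L') \<and> has_signature Q' l l \<and>
        (proj_norm Q P \<noteq> 0 \<or> proj_norm Q L \<noteq> 0) \<longrightarrow>
        (isomorphic_geometries (Q, P, L) (Q', P', L') \<longleftrightarrow>
           (proj_norm Q' P', proj_norm Q' L') = (proj_norm Q P, proj_norm Q L) \<or>
           (proj_norm Q' P', proj_norm Q' L') = (- proj_norm Q P, - proj_norm Q L))) \<and>
     \<comment> \<open>choices of l, and of P and L for a given form, counting differences in sign\<close>
     {l. \<exists>k (Q :: 'v \<Rightarrow> real) P L. universal_conformal_geometry d (Q, P, L) \<and>
           has_signature Q k l \<and> nondegenerate_geometry (Q, P, L)} = {2..d + 1} \<and>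
     (\<forall>k l (Q :: 'v \<Rightarrow> real).
        nondegenerate_form Q \<and> has_signature Q k l \<and> 2 \<le> l \<and> l \<le> d + 1 \<longrightarrow>
        {(proj_norm Q P, proj_norm Q L) | P L.
           universal_conformal_geometry d (Q, P, L) \<and> nondegenerate_geometry (Q, P, L)}
          = {1, 0, -1} \<times> {1, 0, -1} \<and>
        card (geometry_classes (similar_geometries 1)
          {(Q, P, L) | P L. universal_conformal_geometry d (Q, P, L) \<and>
                            nondegenerate_geometry (Q, P, L)}) = 9) \<and>
     \<comment> \<open>number of non-degenerate geometries up to isomorphism; the source prints
        (9d - 1)/2 for odd d, see NOTES\<close>
     (let C = geometry_classes isomorphic_geometries
                {G :: 'v geometry. universal_conformal_geometry d G \<and> nondegenerate_geometry G}
      in finite C \<and>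
         (even d \<longrightarrow> real (card C) = 9 * real d / 2) \<and>
         (odd d \<longrightarrow> real (card C) = (9 * real d + 1) / 2))"
proof (intro conjI allI impI; (elim conjE)?)
  have dim: "dim (UNIV :: 'v set) = d + 3" using assms by simp
  show "\<exists>!kl. has_signature Q (fst kl) (snd kl)" if N: "nondegenerate_form Q" for Q :: "'v \<Rightarrow> real"
  proof -
    obtain k l where "has_signature Q k l" using has_signature_exists[OF N] dim by auto
    then show ?thesis
      using has_signature_unique[OF nondegenerate_form_quadratic[OF N]]
      by (intro ex1I[of _ "(k, l)"]) (auto simp: prod_eq_iff)
  qed
  show "k + l = n" if "has_signature Q k l" for k l and Q :: "'v \<Rightarrow> real"
    using has_signature_dim[OF that] assms by simp
  show "has_signature Q' k l \<longleftrightarrow> isometric_forms Q Q'"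
    if "nondegenerate_form Q" "nondegenerate_form Q'" "has_signature Q k l"
    for k l and Q :: "'v \<Rightarrow> real" and Q' :: "'w \<Rightarrow> real"
    using has_signature_iff_isometric[OF that] .
  show "\<exists>(Q' :: 'v \<Rightarrow> real) P' L'. universal_conformal_geometry d (Q', P', L') \<and>
      has_signature Q' l k \<and> isomorphic_geometries (Q, P, L) (Q', P', L')"
    if G: "universal_conformal_geometry d (Q, P, L)" and sig: "has_signature Q k l"
    for k l and Q :: "'v \<Rightarrow> real" and P L
  proof -
    have Q: "quadratic_form Q" using G by (simp add: nondegenerate_form_quadratic)
    have "similar_geometries (-1) (Q, P, L) (\<lambda>v. - Q v, P, L)"
      by (auto intro!: exI[of _ "\<lambda>v. v"] simp: linear_id[unfolded id_def] bij_id[unfolded id_def])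
    then have "isomorphic_geometries (Q, P, L) (\<lambda>v. - Q v, P, L)"
      unfolding isomorphic_geometries_def by (intro exI[of _ "-1"]) simp
    then show ?thesis
      using universal_conformal_geometry_neg(1)[OF G] has_signature_neg[OF Q sig] by blast
  qed
  show "\<exists>W. maximal_symplectic_subspace Q W"
    if "nondegenerate_form Q" "has_signature Q k l" "k \<ge> l" for k l and Q :: "'v \<Rightarrow> real"
    using maximal_symplectic_subspaces(1)[OF that] .
  show "dim W = 2 * l"
    if "nondegenerate_form Q" "has_signature Q k l" "k \<ge> l" "maximal_symplectic_subspace Q W"
    for k l and Q :: "'v \<Rightarrow> real" and W
    using maximal_symplectic_subspaces(2)[OF that] .
  show "nondegenerate_geometry (Q, P, L) \<longleftrightarrow> l \<ge> 2 \<and> P \<noteq> L"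
    if "universal_conformal_geometry d (Q, P, L)" "has_signature Q k l" "k \<ge> l"
    for k l and Q :: "'v \<Rightarrow> real" and P L
    using nondegenerate_geometry_iff[OF that(1,2)] that(3) by auto
  show "proj_norm Q P \<in> {1, 0, -1}" "proj_norm Q L \<in> {1, 0, -1}"
    if "universal_conformal_geometry d (Q, P, L)" for Q :: "'v \<Rightarrow> real" and P L
    using proj_norm_in[OF that] by auto
  show "isomorphic_geometries (Q, P, L) (Q', P', L') \<longleftrightarrow>
      (proj_norm Q' P', proj_norm Q' L') = (proj_norm Q P, proj_norm Q L)"
    if G: "universal_conformal_geometry d (Q, P, L)" and sig: "has_signature Q k l"
      and G': "universal_conformal_geometry d (Q', P', L')" and sig': "has_signature Q' k l"
      and "k > l" and nz: "\<not> (proj_norm Q P = 0 \<and> proj_norm Q L = 0)"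
    for k l and Q :: "'v \<Rightarrow> real" and P L and Q' :: "'w \<Rightarrow> real" and P' L'
  proof
    assume "isomorphic_geometries (Q, P, L) (Q', P', L')"
    from isomorphic_geometries_invariants[OF G G' sig sig' this] \<open>k > l\<close>
    show "(proj_norm Q' P', proj_norm Q' L') = (proj_norm Q P, proj_norm Q L)" by simp
  next
    assume *: "(proj_norm Q' P', proj_norm Q' L') = (proj_norm Q P, proj_norm Q L)"
    then have "P' \<noteq> L'" using nz proj_norm_self_orthogonal[of d Q' P'] G' by auto
    moreover have "P \<noteq> L" using nz proj_norm_self_orthogonal[of d Q P] G by auto
    ultimately show "isomorphic_geometries (Q, P, L) (Q', P', L')"
      using * isomorphic_geometries_of_norms[OF G G' sig sig'] by simp
  qed
  show "isomorphic_geometries (Q, P, L) (Q', P', L') \<longleftrightarrow>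
      (proj_norm Q' P', proj_norm Q' L') = (proj_norm Q P, proj_norm Q L) \<or>
      (proj_norm Q' P', proj_norm Q' L') = (- proj_norm Q P, - proj_norm Q L)"
    if G: "universal_conformal_geometry d (Q, P, L)" and sig: "has_signature Q l l"
      and G': "universal_conformal_geometry d (Q', P', L')" and sig': "has_signature Q' l l"
      and nz: "proj_norm Q P \<noteq> 0 \<or> proj_norm Q L \<noteq> 0"
    for l and Q :: "'v \<Rightarrow> real" and P L and Q' :: "'w \<Rightarrow> real" and P' L'
  proof
    assume "isomorphic_geometries (Q, P, L) (Q', P', L')"
    from isomorphic_geometries_invariants[OF G G' sig sig' this]
    show "(proj_norm Q' P', proj_norm Q' L') = (proj_norm Q P, proj_norm Q L) \<or>
      (proj_norm Q' P', proj_norm Q' L') = (- proj_norm Q P, - proj_norm Q L)" by simp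
  next
    assume *: "(proj_norm Q' P', proj_norm Q' L') = (proj_norm Q P, proj_norm Q L) \<or>
      (proj_norm Q' P', proj_norm Q' L') = (- proj_norm Q P, - proj_norm Q L)"
    then have "P' \<noteq> L'" using nz proj_norm_self_orthogonal[of d Q' P'] G' by auto
    moreover have "P \<noteq> L" using nz proj_norm_self_orthogonal[of d Q P] G by auto
    ultimately show "isomorphic_geometries (Q, P, L) (Q', P', L')"
      using * isomorphic_geometries_of_norms[OF G G' sig sig'] by auto
  qed
  show "{l. \<exists>k (Q :: 'v \<Rightarrow> real) P L. universal_conformal_geometry d (Q, P, L) \<and>
      has_signature Q k l \<and> nondegenerate_geometry (Q, P, L)} = {2..d + 1}" (is "?ls = _")
  proof (intro equalityI subsetI)
    fix l assume "l \<in> ?ls"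
    then obtain k P L and Q :: "'v \<Rightarrow> real" where G: "universal_conformal_geometry d (Q, P, L)"
      "has_signature Q k l" "nondegenerate_geometry (Q, P, L)" by blast
    then show "l \<in> {2..d + 1}"
      using nondegenerate_geometry_imp[OF G] has_signature_dim[OF G(2)] dim by simp
  next
    fix l assume l: "l \<in> {2..d + 1}"
    obtain Q :: "'v \<Rightarrow> real" where Q: "nondegenerate_form Q" "has_signature Q (d + 3 - l) l"
      using form_with_signature_exists[where 'v='v, of "d + 3 - l" l] dim l by auto
    have "2 \<le> d + 3 - l" "2 \<le> l" using l by auto
    then obtain P L where "universal_conformal_geometry d (Q, P, L)" "nondegenerate_geometry (Q, P, L)"
      using standard_geometry_exists[OF Q(1) dim Q(2), of 1 1] by blast
    then show "l \<in> ?ls" using Q(2) by blast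
  qed
  have k: "2 \<le> k" if "has_signature Q k l" "l \<le> d + 1" for k l and Q :: "'v \<Rightarrow> real"
    using has_signature_dim[OF that(1)] that(2) dim by simp
  show "{(proj_norm Q P, proj_norm Q L) | P L.
      universal_conformal_geometry d (Q, P, L) \<and> nondegenerate_geometry (Q, P, L)}
      = {1, 0, -1} \<times> {1, 0, -1}"
    "card (geometry_classes (similar_geometries 1)
      {(Q, P, L) | P L. universal_conformal_geometry d (Q, P, L) \<and> nondegenerate_geometry (Q, P, L)}) = 9"
    if N: "nondegenerate_form Q" and sig: "has_signature Q k l" and l: "2 \<le> l" "l \<le> d + 1"
    for k l and Q :: "'v \<Rightarrow> real"
    using nine_classes_of_fixed_form[OF N dim sig k[OF sig l(2)] l(1)] .
  show "let C = geometry_classes isomorphic_geometries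
      {G :: 'v geometry. universal_conformal_geometry d G \<and> nondegenerate_geometry G}
    in finite C \<and> (even d \<longrightarrow> real (card C) = 9 * real d / 2) \<and>
      (odd d \<longrightarrow> real (card C) = (9 * real d + 1) / 2)"
  proof -
    define C where "C = geometry_classes isomorphic_geometries
      {G :: 'v geometry. universal_conformal_geometry d G \<and> nondegenerate_geometry G}"
    have "2 * real (card C) = real (9 * d + (if odd d then 1 else 0))"
      unfolding C_def count_nondegenerate_geometries(2)[OF dim, symmetric] by simp
    then show ?thesis
      using count_nondegenerate_geometries(1)[OF dim] unfolding Let_def C_def[symmetric]
      by auto
  qed
qed

end
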